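(* Let $\mathcal G=\mathrm M_{2\times2}(\mathbb R)$ be the monoid of real $2\times2$ matrices under matrix multiplication. Any smooth (left or right) $\mathcal G$-action on a manifold $M$ gives rise to a double graded bundle $(M,\Delta_1,\Delta_2)$ equipped with two complete vector fields $X$, $Y$ of weights $(1,-1)$ and $(-1,1)$ respectively, such that $[X,Y]=\Delta_1-\Delta_2$.
   Context: Monoid actions are such that the unit acts as the identity. A smooth action $h:\mathbb R\times M\to M$ of the multiplicative monoid $(\mathbb R,\cdot)$ is called a homogeneity structure; it makes $h_0:M\to h_0(M)$ a graded bundle, i.e. a fiber bundle admitting local coordinates with assigned non-negative integer weights (base coordinates of weight $0$, fiber coordinates of positive weight, transition maps preserving weights) in which $h_t$ multiplies each coordinate of weight $w$ by $t^w$. Its weight vector field is $\Delta(p)=\frac{d}{dt}|_{t=1}h_t(p)$. A double graded bundle $(M,\Delta_1,\Delta_2)$ is a manifold with two commuting homogeneity structures $h^1,h^2$ ($h^1_t\circ h^2_s=h^2_s\circ h^1_t$ for all $s,t\in\mathbb R$), with weight vector fields $\Delta_1,\Delta_2$. A vector field $Z$ on it has weight $(w_1,w_2)$ if $[\Delta_1,Z]=w_1Z$ and $[\Delta_2,Z]=w_2Z$. *)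

theory Defs
  imports "HOL-Analysis.Analysis"
begin

section \<open>Smooth maps between subsets of Euclidean spaces\<close>

text \<open>In finite dimension, a function is of class C^(k+1) on an open set iff it is differentiable
  there and all its directional derivatives are of class C^k.\<close>

primrec Ck_on :: "nat \<Rightarrow> 'a::euclidean_space set \<Rightarrow> ('a \<Rightarrow> 'b::euclidean_space) \<Rightarrow> bool" where
  "Ck_on 0 U f \<longleftrightarrow> continuous_on U f"
| "Ck_on (Suc k) U f \<longleftrightarrow>
     (\<forall>x\<in>U. f differentiable (at x)) \<and>
     (\<forall>v. Ck_on k U (\<lambda>x. frechet_derivative f (at x) v))"

text \<open>On an arbitrary subset, smooth means: locally the restriction of a smooth map defined on an
  open set. For a relatively open subset of a linear subspace this is smoothness in the sense of
  that subspace, and for an open set it is smoothness in the usual sense.\<close>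

definition smooth_on :: "'a::euclidean_space set \<Rightarrow> ('a \<Rightarrow> 'b::euclidean_space) \<Rightarrow> bool" where
  "smooth_on S f \<longleftrightarrow>
     (\<forall>x\<in>S. \<exists>U g. open U \<and> x \<in> U \<and> (\<forall>k. Ck_on k U g) \<and> (\<forall>y\<in>S \<inter> U. f y = g y))"

section \<open>Smooth manifolds\<close>

text \<open>The points of a manifold are those of the space \<open>mtop\<close>. Its charts take values in a fixed
  linear subspace \<open>model\<close> of a Euclidean space; this admits manifolds of dimension 0,
  which the type class \<open>euclidean_space\<close> alone would exclude.\<close>

record ('m, 'e) mfd =
  mtop :: "'m topology"
  model :: "'e set"
  atlas :: "('m set \<times> ('m \<Rightarrow> 'e)) set"

definition is_chart :: "('m, 'e::euclidean_space) mfd \<Rightarrow> 'm set \<Rightarrow> ('m \<Rightarrow> 'e) \<Rightarrow> bool" where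
  "is_chart M U \<phi> \<longleftrightarrow>
     openin (mtop M) U \<and>
     openin (top_of_set (model M)) (\<phi> ` U) \<and>
     homeomorphic_map (subtopology (mtop M) U) (top_of_set (\<phi> ` U)) \<phi>"

definition smooth_manifold :: "('m, 'e::euclidean_space) mfd \<Rightarrow> bool" where
  "smooth_manifold M \<longleftrightarrow>
     Hausdorff_space (mtop M) \<and> second_countable (mtop M) \<and> subspace (model M) \<and>
     (\<forall>(U, \<phi>)\<in>atlas M. is_chart M U \<phi>) \<and>
     (\<Union>(U, \<phi>)\<in>atlas M. U) = topspace (mtop M) \<and>
     (\<forall>(U, \<phi>)\<in>atlas M. \<forall>(V, \<psi>)\<in>atlas M. smooth_on (\<phi> ` (U \<inter> V)) (\<psi> \<circ> inv_into U \<phi>))"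

definition eucl_mfd :: "('e::euclidean_space, 'e) mfd" where
  "eucl_mfd = \<lparr>mtop = euclidean, model = UNIV, atlas = {(UNIV, \<lambda>x. x)}\<rparr>"

definition prod_mfd :: "('m, 'e::euclidean_space) mfd \<Rightarrow> ('n, 'f::euclidean_space) mfd
    \<Rightarrow> ('m \<times> 'n, 'e \<times> 'f) mfd" where
  "prod_mfd M N =
     \<lparr>mtop = prod_topology (mtop M) (mtop N), model = model M \<times> model N,
      atlas = {(U \<times> V, map_prod \<phi> \<psi>) | U \<phi> V \<psi>. (U, \<phi>) \<in> atlas M \<and> (V, \<psi>) \<in> atlas N}\<rparr>"

definition smooth_map :: "('m, 'e::euclidean_space) mfd \<Rightarrow> ('n, 'f::euclidean_space) mfd
    \<Rightarrow> ('m \<Rightarrow> 'n) \<Rightarrow> bool" where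
  "smooth_map M N f \<longleftrightarrow>
     continuous_map (mtop M) (mtop N) f \<and>
     (\<forall>(U, \<phi>)\<in>atlas M. \<forall>(V, \<psi>)\<in>atlas N.
        smooth_on (\<phi> ` (U \<inter> f -` V)) (\<psi> \<circ> f \<circ> inv_into U \<phi>))"

definition smooth_funs :: "('m, 'e::euclidean_space) mfd \<Rightarrow> ('m \<Rightarrow> real) set" where
  "smooth_funs M = {f. smooth_map M eucl_mfd f}"

section \<open>Vector fields\<close>

text \<open>A tangent vector at \<open>p\<close> is a derivation at \<open>p\<close> of the algebra of smooth functions. Values on
  functions that are not smooth, and values of vector fields outside the manifold, are irrelevant,
  so vector fields are compared by \<open>vf_eq\<close>.\<close>

definition tangent_vector :: "('m, 'e::euclidean_space) mfd \<Rightarrow> 'm \<Rightarrow> (('m \<Rightarrow> real) \<Rightarrow> real) \<Rightarrow> bool"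
  where
  "tangent_vector M p v \<longleftrightarrow>
     (\<forall>f\<in>smooth_funs M. \<forall>g\<in>smooth_funs M.
        (\<forall>a b. v (\<lambda>q. a * f q + b * g q) = a * v f + b * v g) \<and>
        v (\<lambda>q. f q * g q) = f p * v g + g p * v f)"

type_synonym 'm vfield = "'m \<Rightarrow> ('m \<Rightarrow> real) \<Rightarrow> real"

definition vector_field :: "('m, 'e::euclidean_space) mfd \<Rightarrow> 'm vfield \<Rightarrow> bool" where
  "vector_field M X \<longleftrightarrow>
     (\<forall>p\<in>topspace (mtop M). tangent_vector M p (X p)) \<and>
     (\<forall>f\<in>smooth_funs M. (\<lambda>p. X p f) \<in> smooth_funs M)"

definition vf_eq :: "('m, 'e::euclidean_space) mfd \<Rightarrow> 'm vfield \<Rightarrow> 'm vfield \<Rightarrow> bool" where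
  "vf_eq M X Y \<longleftrightarrow> (\<forall>p\<in>topspace (mtop M). \<forall>f\<in>smooth_funs M. X p f = Y p f)"

definition lie_bracket :: "'m vfield \<Rightarrow> 'm vfield \<Rightarrow> 'm vfield" where
  "lie_bracket X Y p f = X p (\<lambda>q. Y q f) - Y p (\<lambda>q. X q f)"

definition complete_vector_field :: "('m, 'e::euclidean_space) mfd \<Rightarrow> 'm vfield \<Rightarrow> bool" where
  "complete_vector_field M X \<longleftrightarrow>
     vector_field M X \<and>
     (\<forall>p\<in>topspace (mtop M). \<exists>\<gamma>. smooth_map (eucl_mfd :: (real, real) mfd) M \<gamma> \<and> \<gamma> 0 = p \<and>
        (\<forall>t. \<forall>f\<in>smooth_funs M. ((\<lambda>s. f (\<gamma> s)) has_real_derivative X (\<gamma> t) f) (at t)))"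

text \<open>The field sending \<open>p\<close> to the velocity of the curve \<open>t \<mapsto> h t p\<close> at time \<open>t0\<close>.\<close>

definition velocity_field :: "(real \<Rightarrow> 'm \<Rightarrow> 'm) \<Rightarrow> real \<Rightarrow> 'm vfield" where
  "velocity_field h t0 p f = deriv (\<lambda>t. f (h t p)) t0"

section \<open>Monoid actions and double graded bundles\<close>

text \<open>Actions of a monoid, given by its multiplication and unit, whose underlying manifold is a
  Euclidean space.\<close>

definition smooth_left_action :: "('g::euclidean_space \<Rightarrow> 'g \<Rightarrow> 'g) \<Rightarrow> 'g
    \<Rightarrow> ('m, 'e::euclidean_space) mfd \<Rightarrow> ('g \<Rightarrow> 'm \<Rightarrow> 'm) \<Rightarrow> bool" where
  "smooth_left_action mul e M act \<longleftrightarrow>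
     smooth_map (prod_mfd eucl_mfd M) M (\<lambda>(g, p). act g p) \<and>
     (\<forall>p\<in>topspace (mtop M). act e p = p \<and> (\<forall>g h. act (mul g h) p = act g (act h p)))"

definition smooth_right_action :: "('g::euclidean_space \<Rightarrow> 'g \<Rightarrow> 'g) \<Rightarrow> 'g
    \<Rightarrow> ('m, 'e::euclidean_space) mfd \<Rightarrow> ('g \<Rightarrow> 'm \<Rightarrow> 'm) \<Rightarrow> bool" where
  "smooth_right_action mul e M act \<longleftrightarrow>
     smooth_map (prod_mfd eucl_mfd M) M (\<lambda>(g, p). act g p) \<and>
     (\<forall>p\<in>topspace (mtop M). act e p = p \<and> (\<forall>g h. act (mul g h) p = act h (act g p)))"

definition homogeneity_structure :: "('m, 'e::euclidean_space) mfd \<Rightarrow> (real \<Rightarrow> 'm \<Rightarrow> 'm) \<Rightarrow> bool"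
  where
  "homogeneity_structure M h \<longleftrightarrow> smooth_left_action (*) 1 M h"

definition weight_vector_field :: "(real \<Rightarrow> 'm \<Rightarrow> 'm) \<Rightarrow> 'm vfield" where
  "weight_vector_field h = velocity_field h 1"

definition double_graded_bundle :: "('m, 'e::euclidean_space) mfd
    \<Rightarrow> (real \<Rightarrow> 'm \<Rightarrow> 'm) \<Rightarrow> (real \<Rightarrow> 'm \<Rightarrow> 'm) \<Rightarrow> bool" where
  "double_graded_bundle M h1 h2 \<longleftrightarrow>
     smooth_manifold M \<and> homogeneity_structure M h1 \<and> homogeneity_structure M h2 \<and>
     (\<forall>s t. \<forall>p\<in>topspace (mtop M). h1 t (h2 s p) = h2 s (h1 t p))"

definition has_weight :: "('m, 'e::euclidean_space) mfd
    \<Rightarrow> (real \<Rightarrow> 'm \<Rightarrow> 'm) \<Rightarrow> (real \<Rightarrow> 'm \<Rightarrow> 'm) \<Rightarrow> 'm vfield \<Rightarrow> int \<Rightarrow> int \<Rightarrow> bool" where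
  "has_weight M h1 h2 Z w1 w2 \<longleftrightarrow>
     vf_eq M (lie_bracket (weight_vector_field h1) Z) (\<lambda>p f. of_int w1 * Z p f) \<and>
     vf_eq M (lie_bracket (weight_vector_field h2) Z) (\<lambda>p f. of_int w2 * Z p f)"

definition mat2 :: "real \<Rightarrow> real \<Rightarrow> real \<Rightarrow> real \<Rightarrow> real^2^2" where
  "mat2 a b c d = vector [vector [a, b], vector [c, d]]"

text \<open>The fundamental vector fields of an action of the matrix monoid that belong to the
  one-parameter groups generated by the matrix units E12 and E21.\<close>

definition upper_field :: "(real^2^2 \<Rightarrow> 'm \<Rightarrow> 'm) \<Rightarrow> 'm vfield" where
  "upper_field act = velocity_field (\<lambda>t. act (mat2 1 t 0 1)) 0"

definition lower_field :: "(real^2^2 \<Rightarrow> 'm \<Rightarrow> 'm) \<Rightarrow> 'm vfield" where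
  "lower_field act = velocity_field (\<lambda>t. act (mat2 1 0 t 1)) 0"

end

theory Submission
  imports Defs
begin

text \<open>A right action of a monoid is a left action of the opposite monoid, so it suffices to treat
  left actions of a Euclidean space with a bilinear multiplication and unit \<open>e\<close>. For a tangent
  direction \<open>A\<close> at \<open>e\<close>, the field value \<open>(A\<^sup>* f) p\<close> is the derivative at \<open>e\<close> in direction \<open>A\<close> of the orbit
  function \<open>F g = f (g p)\<close>. Since \<open>(B\<^sup>* f) (g p) = dF(g) (B g)\<close>, the iterated field
  \<open>(A\<^sup>* (B\<^sup>* f)) p\<close> equals \<open>d\<^sup>2F(e) (A, B) + dF(e) (B A)\<close>, and the symmetry of the second derivative gives
  \<open>[A\<^sup>*, B\<^sup>*] = (B A - A B)\<^sup>*\<close>. All weight and bracket relations are then commutator relations of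
  matrix units. The fields with \<open>A A = 0\<close> are complete because \<open>e + t A\<close> is a
  one-parameter group, and an idempotent \<open>P\<close> gives a homogeneity structure because \<open>e + (t - 1) P\<close>
  is multiplicative in \<open>t\<close>.\<close>

section \<open>Calculus of iterated differentiability\<close>

lemma frechet_derivative_cong_open:
  assumes "open U" "x \<in> U" "\<And>y. y \<in> U \<Longrightarrow> f y = g y" "f differentiable at x"
  shows "frechet_derivative f (at x) = frechet_derivative g (at x)"
  using assms by (metis frechet_derivative_transform_within_open)

lemma frechet_derivative_eqI:
  "(f has_derivative D) (at x) \<Longrightarrow> frechet_derivative f (at x) = D"
  by (rule frechet_derivative_at[symmetric])

text \<open>Openness of \<open>U\<close> makes derivatives at its points depend only on values in
  \<open>U\<close>. The closure proofs below use this to replace a derivative by a formula that is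
  known on \<open>U\<close> alone, after which the induction hypothesis applies.\<close>

lemma Ck_on_cong:
  assumes "open U" "\<And>x. x \<in> U \<Longrightarrow> f x = g x" "Ck_on k U f"
  shows "Ck_on k U g"
  using assms(2,3)
proof (induction k arbitrary: f g)
  case 0
  then show ?case by (simp cong: continuous_on_cong)
next
  case (Suc k)
  have "g differentiable at x" if "x \<in> U" for x
    using Suc.prems that assms(1)
    unfolding differentiable_def by (metis Ck_on.simps(2) differentiable_def has_derivative_transform_within_open)
  moreover have "Ck_on k U (\<lambda>x. frechet_derivative g (at x) v)" for v
  proof (rule Suc.IH)
    show "Ck_on k U (\<lambda>x. frechet_derivative f (at x) v)"
      using Suc.prems by simp
    show "frechet_derivative f (at x) v = frechet_derivative g (at x) v" if "x \<in> U" for x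
      using Suc.prems that assms(1) by (simp add: frechet_derivative_cong_open[of U x f g])
  qed
  ultimately show ?case by simp
qed

lemma Ck_on_subset: "Ck_on k U f \<Longrightarrow> V \<subseteq> U \<Longrightarrow> Ck_on k V f"
  by (induction k arbitrary: f) (auto intro: continuous_on_subset)

lemma Ck_on_local:
  assumes "\<And>x. x \<in> U \<Longrightarrow> \<exists>W. open W \<and> x \<in> W \<and> Ck_on k W f"
  shows "Ck_on k U f"
  using assms
proof (induction k arbitrary: f)
  case 0
  then show ?case
    by (auto simp: continuous_on_eq_continuous_at intro!: continuous_at_imp_continuous_on)
       (metis continuous_on_eq_continuous_at)
next
  case (Suc k)
  have "Ck_on k U (\<lambda>x. frechet_derivative f (at x) v)" for v
    by (rule Suc.IH) (use Suc.prems in fastforce)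
  then show ?case using Suc.prems by fastforce
qed

lemma Ck_on_imp_continuous_on: "Ck_on k U f \<Longrightarrow> continuous_on U f"
  by (cases k)
    (auto intro!: continuous_at_imp_continuous_on differentiable_imp_continuous_within)

lemma Ck_on_SucD: "Ck_on (Suc k) U f \<Longrightarrow> Ck_on k U f"
proof (induction k arbitrary: f)
  case 0
  then show ?case using Ck_on_imp_continuous_on[of "Suc 0"] by simp
next
  case (Suc k)
  then show ?case by (metis Ck_on.simps(2))
qed

section \<open>Closure properties of C^k maps: linear maps, sums, products, composition\<close>

lemma Ck_on_const: "Ck_on k U (\<lambda>x. c)"
  by (induction k arbitrary: c) auto

lemma Ck_on_linear:
  assumes "bounded_linear f" shows "Ck_on k U f"
proof (cases k)
  case 0
  then show ?thesis using assms by (simp add: linear_continuous_on)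
next
  case (Suc n)
  have "frechet_derivative f (at x) = f" for x
    using assms by (metis bounded_linear_imp_has_derivative frechet_derivative_at)
  then show ?thesis
    using Suc assms by (simp add: bounded_linear_imp_differentiable Ck_on_const)
qed

lemma Ck_on_bounded_linear:
  assumes "open U" "bounded_linear L" "Ck_on k U f"
  shows "Ck_on k U (\<lambda>x. L (f x))"
  using assms(3)
proof (induction k arbitrary: f)
  case 0
  then show ?case using assms by (simp add: bounded_linear.continuous_on)
next
  case (Suc k)
  have der: "((\<lambda>x. L (f x)) has_derivative (\<lambda>v. L (frechet_derivative f (at x) v))) (at x)"
    if "x \<in> U" for x
    using Suc.prems that assms(2) by (auto intro: bounded_linear.has_derivative simp: frechet_derivative_works)
  have "Ck_on k U (\<lambda>x. frechet_derivative (\<lambda>x. L (f x)) (at x) v)" for v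
    by (rule Ck_on_cong[OF assms(1) _ Suc.IH[of "\<lambda>x. frechet_derivative f (at x) v"]])
      (use Suc.prems der in \<open>auto simp: frechet_derivative_eqI[OF der]\<close>)
  then show ?case using der by (auto simp: differentiable_def)
qed

lemma Ck_on_add:
  assumes "open U" "Ck_on k U f" "Ck_on k U g"
  shows "Ck_on k U (\<lambda>x. f x + g x)"
  using assms(2,3)
proof (induction k arbitrary: f g)
  case 0
  then show ?case by (simp add: continuous_on_add)
next
  case (Suc k)
  have der: "((\<lambda>x. f x + g x) has_derivative
      (\<lambda>v. frechet_derivative f (at x) v + frechet_derivative g (at x) v)) (at x)"
    if "x \<in> U" for x
    using Suc.prems that by (auto intro!: has_derivative_add simp: frechet_derivative_works)
  have "Ck_on k U (\<lambda>x. frechet_derivative (\<lambda>x. f x + g x) (at x) v)" for v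
    by (rule Ck_on_cong[OF assms(1) _ Suc.IH[of "\<lambda>x. frechet_derivative f (at x) v"
            "\<lambda>x. frechet_derivative g (at x) v"]])
      (use Suc.prems der in \<open>auto simp: frechet_derivative_eqI[OF der]\<close>)
  then show ?case using der by (auto simp: differentiable_def)
qed

lemma Ck_on_sum:
  assumes "open U" "\<And>i. i \<in> I \<Longrightarrow> Ck_on k U (f i)"
  shows "Ck_on k U (\<lambda>x. \<Sum>i\<in>I. f i x)"
  using assms(2)
  by (induction I rule: infinite_finite_induct) (auto intro!: Ck_on_const Ck_on_add[OF assms(1)])

lemma Ck_on_bounded_bilinear:
  assumes "open U" "bounded_bilinear m" "Ck_on k U f" "Ck_on k U g"
  shows "Ck_on k U (\<lambda>x. m (f x) (g x))"
  using assms(3,4)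
proof (induction k arbitrary: f g)
  case 0
  then show ?case using bounded_bilinear.continuous_on[OF assms(2)] by simp
next
  case (Suc k)
  let ?f = "\<lambda>x. frechet_derivative f (at x)" and ?g = "\<lambda>x. frechet_derivative g (at x)"
  have der: "((\<lambda>x. m (f x) (g x)) has_derivative (\<lambda>v. m (f x) (?g x v) + m (?f x v) (g x))) (at x)"
    if "x \<in> U" for x
    using Suc.prems that
    by (auto intro!: bounded_bilinear.FDERIV[OF assms(2)] simp: frechet_derivative_works)
  have "Ck_on k U (\<lambda>x. frechet_derivative (\<lambda>x. m (f x) (g x)) (at x) v)" for v
  proof (rule Ck_on_cong[OF assms(1)])
    \<comment> \<open>Each summand of the product rule keeps one factor undifferentiated, so that
      factor is first lowered from C^(k+1) to C^k.\<close>
    show "Ck_on k U (\<lambda>x. m (f x) (?g x v) + m (?f x v) (g x))"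
      using Suc.prems Ck_on_SucD[OF Suc.prems(1)] Ck_on_SucD[OF Suc.prems(2)]
      by (intro Ck_on_add[OF assms(1)] Suc.IH) auto
  qed (use der in \<open>auto simp: frechet_derivative_eqI[OF der]\<close>)
  then show ?case using der by (auto simp: differentiable_def)
qed

lemma Ck_on_compose:
  fixes f :: "'a::euclidean_space \<Rightarrow> 'b::euclidean_space"
    and g :: "'b \<Rightarrow> 'c::euclidean_space"
  assumes "open U" "f ` U \<subseteq> V" "Ck_on k U f" "Ck_on k V g"
  shows "Ck_on k U (\<lambda>x. g (f x))"
  using assms(3,4)
proof (induction k arbitrary: g)
  case 0
  then show ?case
    using assms(2) by (simp add: continuous_on_compose2)
next
  case (Suc k)
  let ?f = "\<lambda>x. frechet_derivative f (at x)" and ?g = "\<lambda>x. frechet_derivative g (at x)"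
  have lin: "linear (?g (f x))" if "x \<in> U" for x
    using Suc.prems that assms(2) by (auto intro!: linear_frechet_derivative)
  have der: "((\<lambda>x. g (f x)) has_derivative (\<lambda>v. ?g (f x) (?f x v))) (at x)"
    if "x \<in> U" for x
    using Suc.prems that assms(2)
    by (intro has_derivative_compose[where f = f and g = g]) (auto simp flip: frechet_derivative_works)
  \<comment> \<open>In the chain rule the direction in which \<open>g\<close> is differentiated
    varies with \<open>x\<close>, whereas the definition of C^k speaks of fixed directions.
    Expanding the direction in the basis leaves fixed-direction derivatives of \<open>g\<close>,
    composed with \<open>f\<close>, with C^k coefficients.\<close>
  have eq: "?g (f x) w = (\<Sum>b\<in>Basis. (w \<bullet> b) *\<^sub>R ?g (f x) b)" if "x \<in> U" for x w
  proof -
    have "?g (f x) (\<Sum>b\<in>Basis. (w \<bullet> b) *\<^sub>R b) = (\<Sum>b\<in>Basis. (w \<bullet> b) *\<^sub>R ?g (f x) b)"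
      using lin[OF that] by (simp add: linear_sum linear_cmul)
    then show ?thesis by (simp add: euclidean_representation)
  qed
  have "Ck_on k U (\<lambda>x. frechet_derivative (\<lambda>x. g (f x)) (at x) v)" for v
  proof (rule Ck_on_cong[OF assms(1)])
    show "Ck_on k U (\<lambda>x. \<Sum>b\<in>Basis. (?f x v \<bullet> b) *\<^sub>R ?g (f x) b)"
    proof (intro Ck_on_sum[OF assms(1)] Ck_on_bounded_bilinear[OF assms(1) bounded_bilinear_scaleR]
        Ck_on_bounded_linear[OF assms(1) bounded_linear_inner_left])
      show "Ck_on k U (\<lambda>x. ?f x v)" using Suc.prems by simp
      show "Ck_on k U (\<lambda>x. ?g (f x) b)" for b
        by (rule Suc.IH) (use Suc.prems Ck_on_SucD in auto)
    qed
    show "(\<Sum>b\<in>Basis. (?f x v \<bullet> b) *\<^sub>R ?g (f x) b) = frechet_derivative (\<lambda>x. g (f x)) (at x) v"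
      if "x \<in> U" for x
      using frechet_derivative_at[OF der[OF that]] eq[OF that] by metis
  qed
  then show ?case using der by (auto simp: differentiable_def)
qed

section \<open>Symmetry of second derivatives\<close>

lemma has_real_derivative_along_line:
  fixes F :: "'a::euclidean_space \<Rightarrow> real"
  assumes "F differentiable at (x + (s - s0) *\<^sub>R u)"
  shows "((\<lambda>s. F (x + (s - s0) *\<^sub>R u)) has_real_derivative
      frechet_derivative F (at (x + (s - s0) *\<^sub>R u)) u) (at s)"
proof -
  let ?D = "frechet_derivative F (at (x + (s - s0) *\<^sub>R u))"
  have "((\<lambda>s. x + (s - s0) *\<^sub>R u) has_derivative (\<lambda>h. h *\<^sub>R u)) (at s)"
    by (auto intro!: derivative_eq_intros)
  from has_derivative_compose[OF this, of F ?D] assms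
  have "((\<lambda>s. F (x + (s - s0) *\<^sub>R u)) has_derivative (\<lambda>h. ?D (h *\<^sub>R u))) (at s)"
    by (simp add: frechet_derivative_works)
  moreover have "?D (h *\<^sub>R u) = ?D u * h" for h
    using linear_cmul[OF linear_frechet_derivative[OF assms]] by (simp add: mult.commute)
  ultimately show ?thesis by (simp add: has_field_derivative_def)
qed

text \<open>The second difference is the increment over \<open>[0, h]\<close> of the first
  difference taken across \<open>h *\<^sub>R v\<close>, viewed as a function of the displacement
  along \<open>u\<close>. The mean value theorem along \<open>u\<close> produces \<open>s\<close>;
  applied along \<open>v\<close> to the resulting difference of directional derivatives, it produces
  \<open>t\<close>.\<close>

lemma second_difference_mean_value:
  fixes F :: "'a::euclidean_space \<Rightarrow> real"
  assumes F: "\<And>k. Ck_on k UNIV F" and h: "0 < (h::real)"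
  shows "\<exists>s t. 0 < s \<and> s < h \<and> 0 < t \<and> t < h \<and>
    F (x + h *\<^sub>R u + h *\<^sub>R v) - F (x + h *\<^sub>R u) - F (x + h *\<^sub>R v) + F x =
    h * h * frechet_derivative (\<lambda>y. frechet_derivative F (at y) u) (at (x + s *\<^sub>R u + t *\<^sub>R v)) v"
proof -
  let ?D = "\<lambda>y. frechet_derivative F (at y) u"
  have dF: "F differentiable at y" and dD: "?D differentiable at y" for y
    using F[of 2] by (auto simp: numeral_2_eq_2)
  let ?\<phi> = "\<lambda>s. F (x + h *\<^sub>R v + s *\<^sub>R u) - F (x + s *\<^sub>R u)"
  have "(?\<phi> has_real_derivative ?D (x + h *\<^sub>R v + s *\<^sub>R u) - ?D (x + s *\<^sub>R u)) (at s)" for s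
    using has_real_derivative_along_line[of F _ s 0 u] dF by (intro DERIV_diff) auto
  then obtain s where s: "0 < s" "s < h"
    "?\<phi> h - ?\<phi> 0 = h * (?D (x + h *\<^sub>R v + s *\<^sub>R u) - ?D (x + s *\<^sub>R u))"
    using MVT2[OF h, of ?\<phi> "\<lambda>s. ?D (x + h *\<^sub>R v + s *\<^sub>R u) - ?D (x + s *\<^sub>R u)"] by auto
  let ?\<psi> = "\<lambda>t. ?D (x + s *\<^sub>R u + t *\<^sub>R v)"
  have "(?\<psi> has_real_derivative frechet_derivative ?D (at (x + s *\<^sub>R u + t *\<^sub>R v)) v) (at t)" for t
    using has_real_derivative_along_line[of ?D _ t 0 v] dD by auto
  then obtain t where t: "0 < t" "t < h"
    "?\<psi> h - ?\<psi> 0 = h * frechet_derivative ?D (at (x + s *\<^sub>R u + t *\<^sub>R v)) v"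
    using MVT2[OF h, of ?\<psi> "\<lambda>t. frechet_derivative ?D (at (x + s *\<^sub>R u + t *\<^sub>R v)) v"] by auto
  from s t show ?thesis
    by (intro exI[of _ s] exI[of _ t]) (auto simp: algebra_simps)
qed

text \<open>The second difference is symmetric in \<open>u\<close> and \<open>v\<close>, so it
  equals the square of the step times either mixed derivative at some nearby point. Cancelling the
  square and letting the step tend to 0, continuity of both mixed derivatives at \<open>x\<close>
  identifies them.\<close>

lemma frechet_derivative_second_symmetric:
  fixes F :: "'a::euclidean_space \<Rightarrow> real"
  assumes F: "\<And>k. Ck_on k UNIV F"
  shows "frechet_derivative (\<lambda>y. frechet_derivative F (at y) u) (at x) v =
    frechet_derivative (\<lambda>y. frechet_derivative F (at y) v) (at x) u"
proof -
  define D where "D u v y = frechet_derivative (\<lambda>y. frechet_derivative F (at y) u) (at y) v" for u v y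
  have cont: "isCont (D u v) x" for u v
    using F[of 2] unfolding D_def by (auto simp: numeral_2_eq_2 continuous_on_eq_continuous_at)
  have lim: "(\<lambda>n. D u v (x + s n *\<^sub>R u + t n *\<^sub>R v)) \<longlonglongrightarrow> D u v x"
    if st: "\<And>n. 0 < s n \<and> s n < inverse (real (Suc n)) \<and> 0 < t n \<and> t n < inverse (real (Suc n))"
    for s t u v
  proof -
    have "s \<longlonglongrightarrow> 0" "t \<longlonglongrightarrow> 0"
      using st by (auto intro!: tendsto_sandwich[OF _ _ tendsto_const LIMSEQ_inverse_real_of_nat]
          always_eventually intro: less_imp_le)
    then have "(\<lambda>n. x + s n *\<^sub>R u + t n *\<^sub>R v) \<longlonglongrightarrow> x + 0 *\<^sub>R u + 0 *\<^sub>R v"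
      by (intro tendsto_intros)
    with cont show ?thesis using isCont_tendsto_compose[of x "D u v"] by simp
  qed
  define \<Delta> where "\<Delta> h = F (x + h *\<^sub>R u + h *\<^sub>R v) - F (x + h *\<^sub>R u) - F (x + h *\<^sub>R v) + F x" for h
  define h where "h n = inverse (real (Suc n))" for n
  have "\<exists>s t. 0 < s \<and> s < h n \<and> 0 < t \<and> t < h n \<and>
      \<Delta> (h n) = h n * h n * D u v (x + s *\<^sub>R u + t *\<^sub>R v)" for n
    unfolding \<Delta>_def D_def by (rule second_difference_mean_value[OF F]) (simp add: h_def)
  then obtain s t where st: "\<And>n. 0 < s n \<and> s n < h n \<and> 0 < t n \<and> t n < h n \<and>
      \<Delta> (h n) = h n * h n * D u v (x + s n *\<^sub>R u + t n *\<^sub>R v)" by metis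
  \<comment> \<open>The same \<open>\<Delta>\<close> is read with \<open>u\<close> and
    \<open>v\<close> exchanged; only the order of the summands changes.\<close>
  have "\<exists>s t. 0 < s \<and> s < h n \<and> 0 < t \<and> t < h n \<and>
      \<Delta> (h n) = h n * h n * D v u (x + s *\<^sub>R v + t *\<^sub>R u)" for n
    using second_difference_mean_value[OF F, of "h n" x v u]
    unfolding \<Delta>_def D_def by (simp add: h_def algebra_simps)
  then obtain s' t' where st': "\<And>n. 0 < s' n \<and> s' n < h n \<and> 0 < t' n \<and> t' n < h n \<and>
      \<Delta> (h n) = h n * h n * D v u (x + s' n *\<^sub>R v + t' n *\<^sub>R u)" by metis
  have "D u v (x + s n *\<^sub>R u + t n *\<^sub>R v) = D v u (x + s' n *\<^sub>R v + t' n *\<^sub>R u)" for n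
  proof -
    have "h n * h n * D u v (x + s n *\<^sub>R u + t n *\<^sub>R v) =
        h n * h n * D v u (x + s' n *\<^sub>R v + t' n *\<^sub>R u)"
      using st[of n] st'[of n] by linarith
    moreover have "h n * h n \<noteq> 0" by (simp add: h_def)
    ultimately show ?thesis using mult_left_cancel by blast
  qed
  moreover have "(\<lambda>n. D u v (x + s n *\<^sub>R u + t n *\<^sub>R v)) \<longlonglongrightarrow> D u v x"
    by (rule lim) (use st in \<open>auto simp: h_def\<close>)
  moreover have "(\<lambda>n. D v u (x + s' n *\<^sub>R v + t' n *\<^sub>R u)) \<longlonglongrightarrow> D v u x"
    by (rule lim) (use st' in \<open>auto simp: h_def\<close>)
  ultimately have "D u v x = D v u x" using LIMSEQ_unique by simp
  then show ?thesis by (simp add: D_def)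
qed

section \<open>Smooth maps on subsets of Euclidean spaces\<close>

text \<open>On the whole space each local representative agrees with the function on a full
  neighbourhood, and the C^k conditions, being local, glue.\<close>

lemma smooth_on_UNIV_iff: "smooth_on UNIV f \<longleftrightarrow> (\<forall>k. Ck_on k UNIV f)"
proof
  assume f: "smooth_on UNIV f"
  show "\<forall>k. Ck_on k UNIV f"
  proof (intro allI Ck_on_local)
    fix k x
    from f obtain U g where "open U" "x \<in> U" "\<forall>k. Ck_on k U g" "\<forall>y\<in>U. f y = g y"
      unfolding smooth_on_def by (metis IntI UNIV_I)
    then show "\<exists>W. open W \<and> x \<in> W \<and> Ck_on k W f"
      by (metis Ck_on_cong)
  qed
next
  assume "\<forall>k. Ck_on k UNIV f"
  then show "smooth_on UNIV f" unfolding smooth_on_def by blast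
qed

lemma smooth_on_cong:
  assumes "smooth_on S f" "\<And>x. x \<in> S \<Longrightarrow> f x = g x"
  shows "smooth_on S g"
  using assms unfolding smooth_on_def by (metis IntD1)

lemma smooth_onD:
  assumes "smooth_on S f" "x \<in> S"
  shows "\<exists>U g. open U \<and> x \<in> U \<and> (\<forall>k. Ck_on k U g) \<and> (\<forall>y\<in>S \<inter> U. f y = g y)"
  using assms by (simp add: smooth_on_def)

lemma smooth_onI:
  assumes "\<And>x. x \<in> S \<Longrightarrow>
    \<exists>U g. open U \<and> x \<in> U \<and> (\<forall>k. Ck_on k U g) \<and> (\<forall>y\<in>S \<inter> U. f y = g y)"
  shows "smooth_on S f"
  using assms by (simp add: smooth_on_def)

lemma smooth_on_subset:
  assumes "smooth_on S f" "T \<subseteq> S"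
  shows "smooth_on T f"
proof (rule smooth_onI)
  fix x assume "x \<in> T"
  with assms(2) have "x \<in> S" by blast
  obtain U g where "open U" "x \<in> U" "\<forall>k. Ck_on k U g"
      "\<forall>y\<in>S \<inter> U. f y = g y"
    using smooth_onD[OF assms(1) \<open>x \<in> S\<close>] by blast
  with assms(2) show "\<exists>U g. open U \<and> x \<in> U \<and> (\<forall>k. Ck_on k U g) \<and> (\<forall>y\<in>T \<inter> U. f y = g y)"
    by (intro exI[of _ U] exI[of _ g]) auto
qed

lemma smooth_on_local:
  assumes "\<And>x. x \<in> S \<Longrightarrow> \<exists>W. openin (top_of_set S) W \<and> x \<in> W \<and> smooth_on W f"
  shows "smooth_on S f"
proof (rule smooth_onI)
  fix x assume "x \<in> S"
  with assms obtain W where W: "openin (top_of_set S) W" "x \<in> W" "smooth_on W f" by blast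
  then obtain O' where O': "open O'" "W = S \<inter> O'" by (auto simp: openin_open)
  obtain U g where U: "open U" "x \<in> U" "\<forall>k. Ck_on k U g" "\<forall>y\<in>W \<inter> U. f y = g y"
    using smooth_onD[OF W(3,2)] by blast
  then show "\<exists>U g. open U \<and> x \<in> U \<and> (\<forall>k. Ck_on k U g) \<and> (\<forall>y\<in>S \<inter> U. f y = g y)"
    using O' W by (intro exI[of _ "U \<inter> O'"] exI[of _ g]) (auto intro: Ck_on_subset)
qed

lemma smooth_on_const: "smooth_on S (\<lambda>x. c)"
  unfolding smooth_on_def using Ck_on_const open_UNIV by blast

lemma smooth_on_linear: "bounded_linear f \<Longrightarrow> smooth_on S f"
  unfolding smooth_on_def using Ck_on_linear open_UNIV by blast

lemma smooth_on_compose: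
  assumes f: "smooth_on S f" and g: "smooth_on T g" and "f ` S \<subseteq> T"
  shows "smooth_on S (\<lambda>x. g (f x))"
proof (rule smooth_onI)
  fix x assume "x \<in> S"
  obtain U f' where U: "open U" "x \<in> U" "\<forall>k. Ck_on k U f'"
      "\<forall>y\<in>S \<inter> U. f y = f' y"
    using smooth_onD[OF f \<open>x \<in> S\<close>] by blast
  have "f x \<in> T" using \<open>x \<in> S\<close> assms(3) by blast
  obtain V g' where V: "open V" "f x \<in> V" "\<forall>k. Ck_on k V g'"
      "\<forall>y\<in>T \<inter> V. g y = g' y"
    using smooth_onD[OF g \<open>f x \<in> T\<close>] by blast
  \<comment> \<open>The extension \<open>f'\<close> may leave \<open>V\<close> away from
    \<open>x\<close>; the neighbourhood is shrunk until \<open>f'\<close> maps it into the set where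
    \<open>g'\<close> is smooth.\<close>
  define W where "W = U \<inter> f' -` V"
  have "open W"
    unfolding W_def
    by (rule continuous_open_preimage[OF Ck_on_imp_continuous_on[of 0]]) (use U V in simp_all)
  moreover have "x \<in> W" using U V \<open>x \<in> S\<close> by (auto simp: W_def)
  moreover have "Ck_on k W (\<lambda>x. g' (f' x))" for k
  proof (rule Ck_on_compose[OF \<open>open W\<close>, of f' V k g'])
    show "f' ` W \<subseteq> V" by (auto simp: W_def)
    have "Ck_on k U f'" using U by blast
    then show "Ck_on k W f'" by (rule Ck_on_subset) (simp add: W_def)
    show "Ck_on k V g'" using V by simp
  qed
  moreover have "g (f y) = g' (f' y)" if "y \<in> S \<inter> W" for y
    using that U V assms(3) by (auto simp: W_def)
  ultimately show "\<exists>U h. open U \<and> x \<in> U \<and> (\<forall>k. Ck_on k U h) \<and> (\<forall>y\<in>S \<inter> U. g (f y) = h y)"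
    by (intro exI[of _ W] exI[of _ "\<lambda>x. g' (f' x)"]) simp
qed

lemma smooth_on_Pair:
  assumes "smooth_on S f" "smooth_on S g"
  shows "smooth_on S (\<lambda>x. (f x, g x))"
proof (rule smooth_onI)
  fix x assume "x \<in> S"
  obtain U f' where U: "open U" "x \<in> U" "\<forall>k. Ck_on k U f'"
      "\<forall>y\<in>S \<inter> U. f y = f' y"
    using smooth_onD[OF assms(1) \<open>x \<in> S\<close>] by blast
  obtain V g' where V: "open V" "x \<in> V" "\<forall>k. Ck_on k V g'"
      "\<forall>y\<in>S \<inter> V. g y = g' y"
    using smooth_onD[OF assms(2) \<open>x \<in> S\<close>] by blast
  have UV: "open (U \<inter> V)" using U V by auto
  \<comment> \<open>The pair is split as a sum of two linear embeddings applied to the components,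
    so that closure under sums and linear maps suffices.\<close>
  have "Ck_on k (U \<inter> V) (\<lambda>x. (f' x, 0) + (0, g' x))" for k
    using U V
    by (intro Ck_on_add[OF UV] Ck_on_bounded_linear[OF UV, where L = "\<lambda>a. (a, 0)"]
        Ck_on_bounded_linear[OF UV, where L = "\<lambda>a. (0, a)"] bounded_linear_Pair
        bounded_linear_ident bounded_linear_zero) (auto intro: Ck_on_subset)
  then show "\<exists>U h. open U \<and> x \<in> U \<and> (\<forall>k. Ck_on k U h) \<and> (\<forall>y\<in>S \<inter> U. (f y, g y) = h y)"
    using U V UV by (intro exI[of _ "U \<inter> V"] exI[of _ "\<lambda>x. (f' x, 0) + (0, g' x)"]) auto
qed

section \<open>Smooth maps between manifolds\<close>

text \<open>Isolates the chart and covering conditions, on which the composition of smooth maps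
  rests and which are verified directly for products.\<close>

definition charted :: "('m, 'e::euclidean_space) mfd \<Rightarrow> bool" where
  "charted M \<longleftrightarrow> (\<forall>(U, \<phi>)\<in>atlas M. is_chart M U \<phi>) \<and> (\<Union>(U, \<phi>)\<in>atlas M. U) = topspace (mtop M)"

lemma smooth_manifold_imp_charted: "smooth_manifold M \<Longrightarrow> charted M"
  by (simp add: smooth_manifold_def charted_def)

lemma smooth_manifold_transition:
  assumes "smooth_manifold M" "(U, \<phi>) \<in> atlas M" "(V, \<psi>) \<in> atlas M"
  shows "smooth_on (\<phi> ` (U \<inter> V)) (\<psi> \<circ> inv_into U \<phi>)"
proof -
  from assms(1) have "\<forall>(U, \<phi>)\<in>atlas M. \<forall>(V, \<psi>)\<in>atlas M. smooth_on (\<phi> ` (U \<inter> V)) (\<psi> \<circ> inv_into U \<phi>)"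
    by (simp add: smooth_manifold_def)
  from bspec[OF this assms(2)] assms(3) show ?thesis by auto
qed

lemma charted_is_chart: "charted M \<Longrightarrow> (U, \<phi>) \<in> atlas M \<Longrightarrow> is_chart M U \<phi>"
  by (auto simp: charted_def)

lemma charted_cover:
  assumes "charted M" "p \<in> topspace (mtop M)"
  obtains U \<phi> where "(U, \<phi>) \<in> atlas M" "p \<in> U"
  using assms unfolding charted_def by blast

lemma charted_openin:
  assumes "charted M" "(U, \<phi>) \<in> atlas M"
  shows "openin (mtop M) U"
  using charted_is_chart[OF assms] by (simp add: is_chart_def)

lemma charted_subset_topspace:
  "charted M \<Longrightarrow> (U, \<phi>) \<in> atlas M \<Longrightarrow> U \<subseteq> topspace (mtop M)"
  by (simp add: charted_openin openin_subset)

text \<open>A chart provides some continuous inverse. Injectivity identifies it on the chart image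
  with \<open>inv_into U \<phi>\<close>, the inverse that occurs in coordinate expressions.\<close>

lemma charted_homeomorphic_maps:
  assumes "charted M" "(U, \<phi>) \<in> atlas M"
  shows "homeomorphic_maps (subtopology (mtop M) U) (top_of_set (\<phi> ` U)) \<phi> (inv_into U \<phi>)"
proof -
  have U: "topspace (subtopology (mtop M) U) = U"
    using charted_subset_topspace[OF assms] by auto
  have "homeomorphic_map (subtopology (mtop M) U) (top_of_set (\<phi> ` U)) \<phi>"
    using charted_is_chart[OF assms] by (simp add: is_chart_def)
  then obtain g where g: "homeomorphic_maps (subtopology (mtop M) U) (top_of_set (\<phi> ` U)) \<phi> g"
    by (auto simp: homeomorphic_map_maps)
  then have "inj_on \<phi> U"
    using U by (metis homeomorphic_imp_injective_map homeomorphic_maps_map)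
  then have "inv_into U \<phi> y = g y" if "y \<in> \<phi> ` U" for y
    using g U that by (auto simp: homeomorphic_maps_def)
  with g show ?thesis
    by (auto intro: homeomorphic_maps_eq)
qed

lemma charted_inv_into:
  assumes "charted M" "(U, \<phi>) \<in> atlas M" "p \<in> U"
  shows "inv_into U \<phi> (\<phi> p) = p"
  using charted_homeomorphic_maps[OF assms(1,2)] charted_subset_topspace[OF assms(1,2)] assms(3)
  by (auto simp: homeomorphic_maps_def)

lemma charted_inj_on:
  assumes "charted M" "(U, \<phi>) \<in> atlas M"
  shows "inj_on \<phi> U"
  using charted_inv_into[OF assms] by (rule inj_on_inverseI)

lemma charted_continuous_map_inv_into:
  assumes "charted M" "(U, \<phi>) \<in> atlas M"
  shows "continuous_map (top_of_set (\<phi> ` U)) (mtop M) (inv_into U \<phi>)"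
  using charted_homeomorphic_maps[OF assms]
  by (auto simp: homeomorphic_maps_def continuous_map_in_subtopology)

text \<open>The set is the preimage of \<open>V\<close> under the continuous map
  \<open>f \<circ> inv_into U \<phi>\<close> on the chart image. The open set \<open>W\<close>
  obtained from it localises coordinate computations to the points that \<open>f\<close> sends into
  a given chart.\<close>

lemma chart_image_preimage_open:
  assumes "charted M" "(U, \<phi>) \<in> atlas M" "continuous_map (mtop M) X f" "openin X V"
  obtains W where "open W" "\<phi> ` (U \<inter> f -` V) = \<phi> ` U \<inter> W"
proof -
  have "continuous_map (top_of_set (\<phi> ` U)) X (f \<circ> inv_into U \<phi>)"
    using charted_continuous_map_inv_into[OF assms(1,2)] assms(3) by (rule continuous_map_compose)
  then have "openin (top_of_set (\<phi> ` U)) {y \<in> topspace (top_of_set (\<phi> ` U)). (f \<circ> inv_into U \<phi>) y \<in> V}"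
    using assms(4) by (rule openin_continuous_map_preimage)
  also have "{y \<in> topspace (top_of_set (\<phi> ` U)). (f \<circ> inv_into U \<phi>) y \<in> V} = \<phi> ` (U \<inter> f -` V)"
    using charted_inv_into[OF assms(1,2)] by auto
  finally show thesis using that by (auto simp: openin_open)
qed

lemma smooth_mapI:
  assumes "continuous_map (mtop M) (mtop N) f"
    and "\<And>U \<phi> V \<psi>. (U, \<phi>) \<in> atlas M \<Longrightarrow> (V, \<psi>) \<in> atlas N \<Longrightarrow>
      smooth_on (\<phi> ` (U \<inter> f -` V)) (\<psi> \<circ> f \<circ> inv_into U \<phi>)"
  shows "smooth_map M N f"
  using assms by (auto simp: smooth_map_def)

lemma smooth_mapD:
  assumes "smooth_map M N f" "(U, \<phi>) \<in> atlas M" "(V, \<psi>) \<in> atlas N"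
  shows "smooth_on (\<phi> ` (U \<inter> f -` V)) (\<psi> \<circ> f \<circ> inv_into U \<phi>)"
  using assms by (auto simp: smooth_map_def)

lemma smooth_map_continuous: "smooth_map M N f \<Longrightarrow> continuous_map (mtop M) (mtop N) f"
  by (simp add: smooth_map_def)

lemma smooth_map_in_topspace:
  "smooth_map M N f \<Longrightarrow> p \<in> topspace (mtop M) \<Longrightarrow> f p \<in> topspace (mtop N)"
  using smooth_map_continuous continuous_map_image_subset_topspace by fastforce

text \<open>Near a point \<open>p\<close>, the coordinate expression of the composite factors
  through any chart of \<open>B\<close> around \<open>f p\<close>, as a composite of the coordinate
  expressions of \<open>f\<close> and \<open>g\<close>. Such factorisations cover the domain, and
  smoothness is local.\<close>

lemma smooth_map_compose:
  assumes A: "charted A" and B: "charted B"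
    and f: "smooth_map A B f" and g: "smooth_map B C g"
  shows "smooth_map A C (\<lambda>p. g (f p))"
proof (rule smooth_mapI)
  show "continuous_map (mtop A) (mtop C) (\<lambda>p. g (f p))"
    using continuous_map_compose[OF smooth_map_continuous[OF f] smooth_map_continuous[OF g]]
    by (simp add: o_def)
next
  fix U \<phi> W \<omega> assume U: "(U, \<phi>) \<in> atlas A" and W: "(W, \<omega>) \<in> atlas C"
  let ?S = "\<phi> ` (U \<inter> (\<lambda>p. g (f p)) -` W)"
  let ?h = "\<omega> \<circ> (\<lambda>p. g (f p)) \<circ> inv_into U \<phi>"
  note inv = charted_inv_into[OF A U]
  show "smooth_on ?S ?h"
  proof (rule smooth_on_local)
    fix x assume "x \<in> ?S"
    then obtain p where p: "p \<in> U" "g (f p) \<in> W" "x = \<phi> p" by auto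
    have "f p \<in> topspace (mtop B)"
      using smooth_map_in_topspace[OF f] charted_subset_topspace[OF A U] p by blast
    then obtain V \<psi> where V: "(V, \<psi>) \<in> atlas B" "f p \<in> V" using charted_cover[OF B] by blast
    obtain O' where O': "open O'" "\<phi> ` (U \<inter> f -` V) = \<phi> ` U \<inter> O'"
      using chart_image_preimage_open[OF A U smooth_map_continuous[OF f] charted_openin[OF B V(1)]] .
    \<comment> \<open>Membership in \<open>?S\<close> and in \<open>O'\<close> provides two points
      with coordinate \<open>y\<close>, one sent into \<open>W\<close> by the composite and one sent
      into \<open>V\<close> by \<open>f\<close>. The chart inverse shows that they coincide.\<close>
    have fV: "inv_into U \<phi> y \<in> U \<and> f (inv_into U \<phi> y) \<in> V \<and> g (f (inv_into U \<phi> y)) \<in> W"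
      if "y \<in> ?S \<inter> O'" for y
    proof -
      from that have "y \<in> \<phi> ` (U \<inter> f -` V)" using O'(2) by blast
      then obtain p where "p \<in> U" "f p \<in> V" "y = \<phi> p" by blast
      moreover from that obtain q where "q \<in> U" "g (f q) \<in> W" "y = \<phi> q" by auto
      ultimately show ?thesis using inv by metis
    qed
    have "smooth_on (?S \<inter> O') (\<lambda>y. (\<omega> \<circ> g \<circ> inv_into V \<psi>) ((\<psi> \<circ> f \<circ> inv_into U \<phi>) y))"
    proof (rule smooth_on_compose[where f = "\<psi> \<circ> f \<circ> inv_into U \<phi>"])
      show "smooth_on (?S \<inter> O') (\<psi> \<circ> f \<circ> inv_into U \<phi>)"
        by (rule smooth_on_subset[OF smooth_mapD[OF f U V(1)]]) (use O' in blast)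
      show "smooth_on (\<psi> ` (V \<inter> g -` W)) (\<omega> \<circ> g \<circ> inv_into V \<psi>)"
        by (rule smooth_mapD[OF g V(1) W])
      show "(\<psi> \<circ> f \<circ> inv_into U \<phi>) ` (?S \<inter> O') \<subseteq> \<psi> ` (V \<inter> g -` W)"
        using fV by fastforce
    qed
    then have "smooth_on (?S \<inter> O') ?h"
      by (rule smooth_on_cong) (use fV charted_inv_into[OF B V(1)] in simp)
    moreover have "x \<in> O'" using p V(2) O'(2) by blast
    ultimately show "\<exists>W. openin (top_of_set ?S) W \<and> x \<in> W \<and> smooth_on W ?h"
      using \<open>x \<in> ?S\<close> O'(1) by (intro exI[of _ "?S \<inter> O'"]) (auto simp: openin_open)
  qed
qed

section \<open>Euclidean spaces and products as manifolds\<close>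

lemma eucl_mfd_simps [simp]:
  "mtop eucl_mfd = euclidean" "model eucl_mfd = UNIV" "atlas eucl_mfd = {(UNIV, \<lambda>x. x)}"
  by (simp_all add: eucl_mfd_def)

lemma inv_into_ident [simp]: "inv_into UNIV (\<lambda>x. x) = (\<lambda>x. x)"
  by (simp add: fun_eq_iff inv_f_f[of "\<lambda>x. x", unfolded inj_on_def, simplified])


lemma charted_eucl_mfd: "charted eucl_mfd"
  by (simp add: charted_def is_chart_def homeomorphic_map_id[unfolded id_def])

lemma smooth_manifold_eucl_mfd: "smooth_manifold (eucl_mfd :: ('e::euclidean_space, 'e) mfd)"
proof -
  have "second_countable (euclidean :: 'e topology)"
  proof -
    obtain B :: "'e set set" where B: "countable B" "topological_basis B"
      using ex_countable_basis by blast
    have "\<exists>V\<in>B. x \<in> V \<and> V \<subseteq> W" if "open W" "x \<in> W" for W x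
      using topological_basisE[OF B(2) that] by metis
    then show ?thesis
      unfolding second_countable_def
      using B by (intro exI[of _ B]) (auto simp: topological_basis_open)
  qed
  then show ?thesis
    using charted_eucl_mfd
    by (simp add: smooth_manifold_def charted_def o_def smooth_on_linear bounded_linear_ident)
qed

lemma smooth_map_eucl_iff: "smooth_map eucl_mfd eucl_mfd f \<longleftrightarrow> smooth_on UNIV f"
proof -
  have "continuous_on UNIV f" if "smooth_on UNIV f"
    using that Ck_on_imp_continuous_on by (auto simp: smooth_on_UNIV_iff)
  then show ?thesis by (auto simp: smooth_map_def o_def)
qed

lemma smooth_map_const:
  assumes "p \<in> topspace (mtop N)"
  shows "smooth_map M N (\<lambda>x. p)"
  using assms by (intro smooth_mapI) (auto simp: o_def intro: smooth_on_const)

lemma prod_mfd_simps [simp]: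
  "mtop (prod_mfd M N) = prod_topology (mtop M) (mtop N)"
  "model (prod_mfd M N) = model M \<times> model N"
  by (simp_all add: prod_mfd_def)

lemma atlas_prod_mfdI:
  "(U, \<phi>) \<in> atlas M \<Longrightarrow> (V, \<psi>) \<in> atlas N \<Longrightarrow> (U \<times> V, map_prod \<phi> \<psi>) \<in> atlas (prod_mfd M N)"
  by (auto simp: prod_mfd_def)

lemma atlas_prod_mfdE:
  assumes "(W, \<omega>) \<in> atlas (prod_mfd M N)"
  obtains U \<phi> V \<psi> where "(U, \<phi>) \<in> atlas M" "(V, \<psi>) \<in> atlas N" "W = U \<times> V" "\<omega> = map_prod \<phi> \<psi>"
  using assms by (auto simp: prod_mfd_def)

lemma map_prod_image_Times: "map_prod f g ` (A \<times> B) = f ` A \<times> g ` B"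
  by auto

lemma charted_prod_mfd:
  assumes M: "charted M" and N: "charted N"
  shows "charted (prod_mfd M N)"
  unfolding charted_def
proof (intro conjI ballI)
  have "is_chart (prod_mfd M N) W \<omega>" if "(W, \<omega>) \<in> atlas (prod_mfd M N)" for W \<omega>
  proof -
    from that obtain U \<phi> V \<psi> where U: "(U, \<phi>) \<in> atlas M" and V: "(V, \<psi>) \<in> atlas N"
      and W: "W = U \<times> V" "\<omega> = map_prod \<phi> \<psi>" by (rule atlas_prod_mfdE)
    have "openin (prod_topology (mtop M) (mtop N)) (U \<times> V)"
      using charted_openin[OF M U] charted_openin[OF N V] by (simp add: openin_prod_Times_iff)
    moreover have "openin (top_of_set (model M \<times> model N)) (\<phi> ` U \<times> \<psi> ` V)"
      using charted_is_chart[OF M U] charted_is_chart[OF N V] by (simp add: is_chart_def openin_Times)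
    moreover have "homeomorphic_maps (subtopology (prod_topology (mtop M) (mtop N)) (U \<times> V))
        (top_of_set (\<phi> ` U \<times> \<psi> ` V)) (\<lambda>(x, y). (\<phi> x, \<psi> y)) (\<lambda>(x, y). (inv_into U \<phi> x, inv_into V \<psi> y))"
      using charted_homeomorphic_maps[OF M U] charted_homeomorphic_maps[OF N V]
      by (simp add: subtopology_Times homeomorphic_maps_prod flip: prod_topology_subtopology_eu)
    then have "homeomorphic_map (subtopology (prod_topology (mtop M) (mtop N)) (U \<times> V))
        (top_of_set (\<phi> ` U \<times> \<psi> ` V)) (map_prod \<phi> \<psi>)"
      unfolding homeomorphic_map_maps map_prod_def by blast
    ultimately show ?thesis
      by (simp add: is_chart_def W map_prod_image_Times)
  qed
  then show "case W\<omega> of (W, \<omega>) \<Rightarrow> is_chart (prod_mfd M N) W \<omega>" if "W\<omega> \<in> atlas (prod_mfd M N)" for W\<omega>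
    using that by (cases W\<omega>) auto
  have "(\<Union>(W, \<omega>)\<in>atlas (prod_mfd M N). W) = (\<Union>(U, \<phi>)\<in>atlas M. U) \<times> (\<Union>(V, \<psi>)\<in>atlas N. V)"
  proof (intro equalityI subsetI)
    fix z assume "z \<in> (\<Union>(W, \<omega>)\<in>atlas (prod_mfd M N). W)"
    then obtain W \<omega> where "(W, \<omega>) \<in> atlas (prod_mfd M N)" "z \<in> W" by blast
    then show "z \<in> (\<Union>(U, \<phi>)\<in>atlas M. U) \<times> (\<Union>(V, \<psi>)\<in>atlas N. V)"
      by (auto elim!: atlas_prod_mfdE)
  next
    fix z assume "z \<in> (\<Union>(U, \<phi>)\<in>atlas M. U) \<times> (\<Union>(V, \<psi>)\<in>atlas N. V)"
    then obtain U \<phi> V \<psi> where "(U, \<phi>) \<in> atlas M" "(V, \<psi>) \<in> atlas N" "z \<in> U \<times> V" by auto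
    then show "z \<in> (\<Union>(W, \<omega>)\<in>atlas (prod_mfd M N). W)"
      by (intro UN_I[OF atlas_prod_mfdI]) auto
  qed
  then show "(\<Union>(W, \<omega>)\<in>atlas (prod_mfd M N). W) = topspace (mtop (prod_mfd M N))"
    using M N by (simp add: charted_def)
qed

lemma inv_into_map_prod:
  assumes "inj_on \<phi> U" "inj_on \<psi> V" "z \<in> \<phi> ` U \<times> \<psi> ` V"
  shows "inv_into (U \<times> V) (map_prod \<phi> \<psi>) z = (inv_into U \<phi> (fst z), inv_into V \<psi> (snd z))"
proof -
  from assms(3) obtain p q where pq: "p \<in> U" "q \<in> V" "z = map_prod \<phi> \<psi> (p, q)" by auto
  have "inj_on (map_prod \<phi> \<psi>) (U \<times> V)" using assms by (simp add: map_prod_inj_on)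
  with pq assms show ?thesis using inv_into_f_f[of "map_prod \<phi> \<psi>" "U \<times> V" "(p, q)"] by simp
qed

text \<open>In coordinates the projection is a linear projection followed by a chart transition of
  \<open>M\<close>, which is why the compatibility of the charts of this factor enters.\<close>

lemma smooth_map_fst:
  assumes M: "smooth_manifold M" and N: "charted N"
  shows "smooth_map (prod_mfd M N) M fst"
proof (rule smooth_mapI)
  show "continuous_map (mtop (prod_mfd M N)) (mtop M) fst" by (simp add: continuous_map_fst)
next
  fix W \<omega> U' \<phi>' assume W: "(W, \<omega>) \<in> atlas (prod_mfd M N)" and U': "(U', \<phi>') \<in> atlas M"
  from W obtain U \<phi> V \<psi> where U: "(U, \<phi>) \<in> atlas M" and V: "(V, \<psi>) \<in> atlas N"
    and W: "W = U \<times> V" "\<omega> = map_prod \<phi> \<psi>" by (rule atlas_prod_mfdE)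
  note M' = smooth_manifold_imp_charted[OF M]
  have "smooth_on (\<omega> ` (W \<inter> fst -` U')) (\<lambda>z. (\<phi>' \<circ> inv_into U \<phi>) (fst z))"
  proof (rule smooth_on_compose[where f = fst])
    show "smooth_on (\<phi> ` (U \<inter> U')) (\<phi>' \<circ> inv_into U \<phi>)"
      by (rule smooth_manifold_transition[OF M U U'])
    show "smooth_on (\<omega> ` (W \<inter> fst -` U')) fst"
      by (rule smooth_on_linear[OF bounded_linear_fst])
  qed (auto simp: W)
  then show "smooth_on (\<omega> ` (W \<inter> fst -` U')) (\<phi>' \<circ> fst \<circ> inv_into W \<omega>)"
    by (rule smooth_on_cong)
      (auto simp: W inv_into_map_prod[OF charted_inj_on[OF M' U] charted_inj_on[OF N V]])
qed

lemma smooth_map_snd: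
  assumes M: "charted M" and N: "smooth_manifold N"
  shows "smooth_map (prod_mfd M N) N snd"
proof (rule smooth_mapI)
  show "continuous_map (mtop (prod_mfd M N)) (mtop N) snd" by (simp add: continuous_map_snd)
next
  fix W \<omega> V' \<psi>' assume W: "(W, \<omega>) \<in> atlas (prod_mfd M N)" and V': "(V', \<psi>') \<in> atlas N"
  from W obtain U \<phi> V \<psi> where U: "(U, \<phi>) \<in> atlas M" and V: "(V, \<psi>) \<in> atlas N"
    and W: "W = U \<times> V" "\<omega> = map_prod \<phi> \<psi>" by (rule atlas_prod_mfdE)
  note N' = smooth_manifold_imp_charted[OF N]
  have "smooth_on (\<omega> ` (W \<inter> snd -` V')) (\<lambda>z. (\<psi>' \<circ> inv_into V \<psi>) (snd z))"
  proof (rule smooth_on_compose[where f = snd])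
    show "smooth_on (\<psi> ` (V \<inter> V')) (\<psi>' \<circ> inv_into V \<psi>)"
      by (rule smooth_manifold_transition[OF N V V'])
    show "smooth_on (\<omega> ` (W \<inter> snd -` V')) snd"
      by (rule smooth_on_linear[OF bounded_linear_snd])
  qed (auto simp: W)
  then show "smooth_on (\<omega> ` (W \<inter> snd -` V')) (\<psi>' \<circ> snd \<circ> inv_into W \<omega>)"
    by (rule smooth_on_cong)
      (auto simp: W inv_into_map_prod[OF charted_inj_on[OF M U] charted_inj_on[OF N' V]])
qed

lemma smooth_map_Pair:
  assumes f: "smooth_map A M f" and g: "smooth_map A N g"
  shows "smooth_map A (prod_mfd M N) (\<lambda>x. (f x, g x))"
proof (rule smooth_mapI)
  show "continuous_map (mtop A) (mtop (prod_mfd M N)) (\<lambda>x. (f x, g x))"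
    using f g by (simp add: continuous_map_pairedI smooth_map_continuous)
next
  fix T \<theta> W \<omega> assume T: "(T, \<theta>) \<in> atlas A" and W: "(W, \<omega>) \<in> atlas (prod_mfd M N)"
  from W obtain U \<phi> V \<psi> where U: "(U, \<phi>) \<in> atlas M" and V: "(V, \<psi>) \<in> atlas N"
    and W: "W = U \<times> V" "\<omega> = map_prod \<phi> \<psi>" by (rule atlas_prod_mfdE)
  let ?S = "\<theta> ` (T \<inter> (\<lambda>x. (f x, g x)) -` W)"
  have "smooth_on ?S (\<phi> \<circ> f \<circ> inv_into T \<theta>)" "smooth_on ?S (\<psi> \<circ> g \<circ> inv_into T \<theta>)"
    by (rule smooth_on_subset[OF smooth_mapD[OF f T U]] smooth_on_subset[OF smooth_mapD[OF g T V]];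
        auto simp: W)+
  from smooth_on_Pair[OF this]
  show "smooth_on ?S (\<omega> \<circ> (\<lambda>x. (f x, g x)) \<circ> inv_into T \<theta>)"
    by (rule smooth_on_cong) (simp add: W)
qed

section \<open>Smooth functions and differentiation in a parameter\<close>

lemma smooth_on_imp_continuous_on:
  assumes "smooth_on S f"
  shows "continuous_on S f"
proof -
  have "continuous (at x within S) f" if x: "x \<in> S" for x
  proof -
    obtain U g where U: "open U" "x \<in> U" "\<forall>k. Ck_on k U g" "\<forall>y\<in>S \<inter> U. f y = g y"
      using smooth_onD[OF assms x] by blast
    then have "isCont g x"
      using Ck_on_imp_continuous_on[of 0 U g] by (simp add: continuous_on_eq_continuous_at)
    then have "continuous (at x within S) g" by (rule continuous_at_imp_continuous_at_within)
    moreover have "\<forall>\<^sub>F y in at x within S. g y = f y"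
      unfolding eventually_at_topological using U by (intro exI[of _ U]) auto
    moreover have "f x = g x" using U x by simp
    ultimately show ?thesis
      unfolding continuous_within using Lim_transform_eventually by metis
  qed
  then show ?thesis by (simp add: continuous_on_eq_continuous_within)
qed

text \<open>Continuity follows from smoothness in charts: on a chart domain the function is
  \<open>f \<circ> inv_into U \<phi> \<circ> \<phi>\<close>, a composite of continuous maps, and
  these pieces are pasted over the open cover by chart domains.\<close>

lemma smooth_funs_iff:
  assumes M: "charted M"
  shows "f \<in> smooth_funs M \<longleftrightarrow> (\<forall>(U, \<phi>)\<in>atlas M. smooth_on (\<phi> ` U) (f \<circ> inv_into U \<phi>))"
proof
  assume "f \<in> smooth_funs M"
  then show "\<forall>(U, \<phi>)\<in>atlas M. smooth_on (\<phi> ` U) (f \<circ> inv_into U \<phi>)"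
    by (auto simp: smooth_funs_def smooth_map_def o_def)
next
  assume smooth: "\<forall>(U, \<phi>)\<in>atlas M. smooth_on (\<phi> ` U) (f \<circ> inv_into U \<phi>)"
  have "continuous_map (mtop M) euclidean f"
  proof (rule pasting_lemma[where I = "atlas M" and T = fst and f = "\<lambda>_. f"])
    fix c assume c: "c \<in> atlas M"
    obtain U \<phi> where U: "c = (U, \<phi>)" "(U, \<phi>) \<in> atlas M" using c by (cases c) auto
    show "openin (mtop M) (fst c)" using charted_openin[OF M U(2)] U by simp
    have "continuous_map (subtopology (mtop M) U) euclidean (f \<circ> inv_into U \<phi> \<circ> \<phi>)"
    proof (rule continuous_map_compose)
      show "continuous_map (subtopology (mtop M) U) (top_of_set (\<phi> ` U)) \<phi>"
        using charted_homeomorphic_maps[OF M U(2)] by (simp add: homeomorphic_maps_def)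
      show "continuous_map (top_of_set (\<phi> ` U)) euclidean (f \<circ> inv_into U \<phi>)"
        using smooth_on_imp_continuous_on[of "\<phi> ` U" "f \<circ> inv_into U \<phi>"] bspec[OF smooth U(2)]
        by (simp add: o_def)
    qed
    then show "continuous_map (subtopology (mtop M) (fst c)) euclidean f"
      unfolding U(1) fst_conv by (rule continuous_map_eq) (use charted_inv_into[OF M U(2)] in auto)
  next
    fix p assume "p \<in> topspace (mtop M)"
    then obtain U \<phi> where "(U, \<phi>) \<in> atlas M" "p \<in> U" by (rule charted_cover[OF M])
    then show "\<exists>c. c \<in> atlas M \<and> p \<in> fst c \<and> f p = f p" by force
  qed simp
  then show "f \<in> smooth_funs M"
    using smooth by (auto simp: smooth_funs_def smooth_map_def o_def)
qed

text \<open>In a chart, \<open>\<Phi>\<close> is locally the restriction of a smooth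
  \<open>G\<close> on an open set of the ambient space. Moving in direction \<open>(v, 0)\<close>
  stays over the chart image, so this derivative of \<open>G\<close> is determined by
  \<open>\<Phi>\<close> and is a smooth local representative. Applied to a function pulled back
  along the action, it gives the smoothness of fundamental fields.\<close>

lemma smooth_funs_partial_derivative:
  fixes M :: "('m, 'e::euclidean_space) mfd" and \<Phi> :: "'g::euclidean_space \<times> 'm \<Rightarrow> real"
  assumes M: "charted M" and \<Phi>: "\<Phi> \<in> smooth_funs (prod_mfd eucl_mfd M)"
  shows "(\<lambda>p. frechet_derivative (\<lambda>g. \<Phi> (g, p)) (at a) v) \<in> smooth_funs M"
  unfolding smooth_funs_iff[OF M]
proof clarify
  fix U \<phi> assume U: "(U, \<phi>) \<in> atlas M"
  let ?D = "\<lambda>p. frechet_derivative (\<lambda>g. \<Phi> (g, p)) (at a) v"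
  have "(UNIV \<times> U, map_prod (\<lambda>x. x) \<phi>) \<in> atlas (prod_mfd (eucl_mfd :: ('g, 'g) mfd) M)"
    by (rule atlas_prod_mfdI) (simp_all add: U)
  then have "smooth_on (map_prod (\<lambda>x. x) \<phi> ` (UNIV \<times> U)) (\<Phi> \<circ> inv_into (UNIV \<times> U) (map_prod (\<lambda>x. x) \<phi>))"
    using \<Phi> smooth_funs_iff[OF charted_prod_mfd[OF charted_eucl_mfd M]] by blast
  then have smooth: "smooth_on (UNIV \<times> \<phi> ` U) (\<lambda>z. \<Phi> (fst z, inv_into U \<phi> (snd z)))"
    unfolding map_prod_image_Times image_ident
    by (rule smooth_on_cong)
      (auto simp: inv_into_map_prod[OF _ charted_inj_on[OF M U]])
  show "smooth_on (\<phi> ` U) (?D \<circ> inv_into U \<phi>)"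
  proof (rule smooth_onI)
    fix x assume "x \<in> \<phi> ` U"
    then have "(a, x) \<in> UNIV \<times> \<phi> ` U" by simp
    then obtain W G where W: "open W" "(a, x) \<in> W" and G: "\<forall>k. Ck_on k W G"
      and eq: "\<forall>z\<in>UNIV \<times> \<phi> ` U \<inter> W. \<Phi> (fst z, inv_into U \<phi> (snd z)) = G z"
      using smooth_onD[OF smooth] by blast
    let ?G = "\<lambda>y. frechet_derivative G (at (a, y)) (v, 0)"
    define W' where "W' = Pair a -` W"
    have "open W'"
      unfolding W'_def using W(1) by (intro open_vimage continuous_intros)
    have "Ck_on k W' ?G" for k
    proof (rule Ck_on_compose[OF \<open>open W'\<close>, of "Pair a" W])
      have "Ck_on k W' (\<lambda>y. (a, 0) + (0, y))"
        by (intro Ck_on_add[OF \<open>open W'\<close>] Ck_on_const Ck_on_linear bounded_linear_Pair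
            bounded_linear_ident bounded_linear_zero)
      then show "Ck_on k W' (Pair a)" by simp
      have "Ck_on (Suc k) W G" using G by blast
      then show "Ck_on k W (\<lambda>z. frechet_derivative G (at z) (v, 0))" by simp
    qed (auto simp: W'_def)
    moreover have "(?D \<circ> inv_into U \<phi>) y = ?G y" if y: "y \<in> \<phi> ` U \<inter> W'" for y
    proof -
      have "Ck_on (Suc 0) W G" using G by blast
      then have "(G has_derivative frechet_derivative G (at (a, y))) (at (a, y))"
        using y by (auto simp: W'_def simp flip: frechet_derivative_works)
      then have "((\<lambda>g. G (g, y)) has_derivative (\<lambda>h. frechet_derivative G (at (a, y)) (h, 0))) (at a)"
        by (rule has_derivative_compose[rotated]) (auto intro!: derivative_eq_intros)
      \<comment> \<open>Since \<open>y\<close> stays fixed in the chart image, \<open>G\<close>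
        represents \<open>\<Phi>\<close> for every \<open>g\<close> in the open slice of
        \<open>W\<close> at height \<open>y\<close>, not only at \<open>a\<close>.\<close>
      then have "((\<lambda>g. \<Phi> (g, inv_into U \<phi> y)) has_derivative
          (\<lambda>h. frechet_derivative G (at (a, y)) (h, 0))) (at a)"
      proof (rule has_derivative_transform_within_open)
        show "open ((\<lambda>g. (g, y)) -` W)"
          using W(1) by (intro open_vimage continuous_intros)
        show "G (g, y) = \<Phi> (g, inv_into U \<phi> y)" if "g \<in> (\<lambda>g. (g, y)) -` W" for g
          using bspec[OF eq, of "(g, y)"] that y by simp
      qed (use y in \<open>simp add: W'_def\<close>)
      then show ?thesis by (simp add: frechet_derivative_eqI)
    qed
    ultimately show "\<exists>V g. open V \<and> x \<in> V \<and> (\<forall>k. Ck_on k V g) \<and>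
        (\<forall>y\<in>\<phi> ` U \<inter> V. (?D \<circ> inv_into U \<phi>) y = g y)"
      using \<open>open W'\<close> W(2) by (intro exI[of _ W'] exI[of _ ?G]) (auto simp: W'_def)
  qed
qed

section \<open>Fundamental vector fields of a monoid action\<close>

text \<open>Expanding the moving direction \<open>L g\<close> in the basis reduces this to the
  product rule. The first term is the second derivative with the direction frozen at
  \<open>L x\<close>; the second comes from the motion of the direction.\<close>

lemma has_derivative_directional_derivative:
  fixes F :: "'a::euclidean_space \<Rightarrow> real"
  assumes F: "\<And>k. Ck_on k UNIV F" and L: "bounded_linear L"
  shows "((\<lambda>g. frechet_derivative F (at g) (L g)) has_derivative
    (\<lambda>v. frechet_derivative (\<lambda>g. frechet_derivative F (at g) (L x)) (at x) v +
      frechet_derivative F (at x) (L v))) (at x)"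
proof -
  define D where "D b g = frechet_derivative F (at g) b" for b g
  let ?D' = "\<lambda>b. frechet_derivative (D b) (at x)"
  have dF: "F differentiable at g" and dD: "D b differentiable at g" for g b
    using F[of 2] unfolding D_def by (auto simp: numeral_2_eq_2)
  have expand: "D w g = (\<Sum>b\<in>Basis. (w \<bullet> b) * D b g)" for w g
  proof -
    have "D (\<Sum>b\<in>Basis. (w \<bullet> b) *\<^sub>R b) g = (\<Sum>b\<in>Basis. (w \<bullet> b) * D b g)"
      unfolding D_def using linear_frechet_derivative[OF dF] by (simp add: linear_sum linear_cmul)
    then show ?thesis by (simp add: euclidean_representation)
  qed
  have D': "(D b has_derivative ?D' b) (at x)" for b
    using dD by (simp flip: frechet_derivative_works)
  have "((\<lambda>g. \<Sum>b\<in>Basis. (L x \<bullet> b) * D b g) has_derivative (\<lambda>v. \<Sum>b\<in>Basis. (L x \<bullet> b) * ?D' b v)) (at x)"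
    by (intro has_derivative_sum has_derivative_mult_right D')
  then have "?D' (L x) = (\<lambda>v. \<Sum>b\<in>Basis. (L x \<bullet> b) * ?D' b v)"
    unfolding expand[symmetric] by (rule frechet_derivative_eqI)
  moreover have "((\<lambda>g. \<Sum>b\<in>Basis. (L g \<bullet> b) * D b g) has_derivative
      (\<lambda>v. \<Sum>b\<in>Basis. (L x \<bullet> b) * ?D' b v + (L v \<bullet> b) * D b x)) (at x)"
    by (intro has_derivative_sum has_derivative_mult D' has_derivative_inner_left
        bounded_linear_imp_has_derivative[OF L])
  ultimately have "((\<lambda>g. D (L g) g) has_derivative (\<lambda>v. ?D' (L x) v + D (L v) x)) (at x)"
    by (simp add: sum.distrib flip: expand)
  then show ?thesis by (simp add: D_def[abs_def])
qed

text \<open>The straight line through \<open>e\<close> takes the place of the exponential curve: the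
  monoid is a whole vector space, so the line stays inside it, and both curves have velocity
  \<open>A\<close> at 0.\<close>

definition fundamental_field :: "'g::real_vector \<Rightarrow> ('g \<Rightarrow> 'm \<Rightarrow> 'm) \<Rightarrow> 'g \<Rightarrow> 'm vfield" where
  "fundamental_field e act A = velocity_field (\<lambda>t. act (e + t *\<^sub>R A)) 0"

lemma velocity_field_shift: "velocity_field (\<lambda>t. h (t - t0)) t0 = velocity_field h 0"
proof -
  have "deriv (\<lambda>t. F (t - t0)) t0 = deriv F 0" for F :: "real \<Rightarrow> real"
    unfolding deriv_def using DERIV_shift[of "\<lambda>t. F (t - t0)" _ 0 t0] by simp
  then show ?thesis unfolding velocity_field_def by (intro ext)
qed

text \<open>Weight vector fields are velocities at time 1 and fundamental fields velocities at time
  0. After this shift of time a single commutator formula covers all the brackets.\<close>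

lemma weight_vector_field_affine:
  "weight_vector_field (\<lambda>t. act (e + (t - 1) *\<^sub>R A)) = fundamental_field e act A"
  unfolding weight_vector_field_def fundamental_field_def
  by (rule velocity_field_shift[of "\<lambda>t. act (e + t *\<^sub>R A)"])

locale smooth_monoid_action =
  fixes mul :: "'g::euclidean_space \<Rightarrow> 'g \<Rightarrow> 'g" and e :: 'g
    and M :: "('m, 'e::euclidean_space) mfd" and act :: "'g \<Rightarrow> 'm \<Rightarrow> 'm"
  assumes bilinear: "bounded_bilinear mul"
    and left_unit: "mul e g = g" and right_unit: "mul g e = g"
    and manifold: "smooth_manifold M"
    and action: "smooth_left_action mul e M act"
begin

sublocale mul: bounded_bilinear mul by (rule bilinear)

abbreviation "field \<equiv> fundamental_field e act"

lemma charted_M: "charted M"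
  by (rule smooth_manifold_imp_charted[OF manifold])

lemma smooth_act: "smooth_map (prod_mfd eucl_mfd M) M (\<lambda>(g, p). act g p)"
  using action by (simp add: smooth_left_action_def)

lemma act_unit: "p \<in> topspace (mtop M) \<Longrightarrow> act e p = p"
  using action by (simp add: smooth_left_action_def)

lemma act_mul: "p \<in> topspace (mtop M) \<Longrightarrow> act (mul g h) p = act g (act h p)"
  using action by (simp add: smooth_left_action_def)

lemma act_in_topspace: "p \<in> topspace (mtop M) \<Longrightarrow> act g p \<in> topspace (mtop M)"
  using smooth_map_in_topspace[OF smooth_act, of "(g, p)"] by simp

lemma smooth_map_act:
  assumes A: "charted A" and g: "smooth_map A eucl_mfd g" and p: "smooth_map A M p"
  shows "smooth_map A M (\<lambda>x. act (g x) (p x))"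
  using smooth_map_compose[OF A charted_prod_mfd[OF charted_eucl_mfd charted_M]
      smooth_map_Pair[OF g p] smooth_act] by simp

text \<open>Transfers differentiation along the action to calculus on the Euclidean space of the
  monoid, where second derivatives are symmetric.\<close>

lemma smooth_orbit:
  assumes "p \<in> topspace (mtop M)" "f \<in> smooth_funs M"
  shows "Ck_on k UNIV (\<lambda>g. f (act g p))"
proof -
  have "smooth_map eucl_mfd M (\<lambda>g. act g p)"
    by (intro smooth_map_act charted_eucl_mfd smooth_map_const assms)
      (simp add: smooth_map_eucl_iff smooth_on_linear bounded_linear_ident)
  then have "smooth_map eucl_mfd eucl_mfd (\<lambda>g. f (act g p))"
    by (rule smooth_map_compose[OF charted_eucl_mfd charted_M])
      (use assms(2) in \<open>simp add: smooth_funs_def\<close>)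
  then show ?thesis by (simp add: smooth_map_eucl_iff smooth_on_UNIV_iff)
qed

lemma orbit_differentiable:
  assumes "p \<in> topspace (mtop M)" "f \<in> smooth_funs M"
  shows "(\<lambda>g. f (act g p)) differentiable at g"
  using smooth_orbit[OF assms, of 1] by simp

lemma orbit_has_real_derivative:
  assumes "p \<in> topspace (mtop M)" "f \<in> smooth_funs M"
  shows "((\<lambda>t. f (act (e + t *\<^sub>R A) p)) has_real_derivative
    frechet_derivative (\<lambda>g. f (act g p)) (at (e + t *\<^sub>R A)) A) (at t)"
  using has_real_derivative_along_line[of "\<lambda>g. f (act g p)" e t 0 A] orbit_differentiable[OF assms]
  by simp

lemma field_eq:
  assumes "p \<in> topspace (mtop M)" "f \<in> smooth_funs M"
  shows "field A p f = frechet_derivative (\<lambda>g. f (act g p)) (at e) A"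
  using orbit_has_real_derivative[OF assms, of A 0]
  by (simp add: fundamental_field_def velocity_field_def DERIV_imp_deriv)

lemma field_has_real_derivative:
  assumes "p \<in> topspace (mtop M)" "f \<in> smooth_funs M"
  shows "((\<lambda>t. f (act (e + t *\<^sub>R A) p)) has_real_derivative field A p f) (at 0)"
  using orbit_has_real_derivative[OF assms, of A 0] by (simp add: field_eq[OF assms])

lemma field_diff:
  assumes "p \<in> topspace (mtop M)" "f \<in> smooth_funs M"
  shows "field (A - B) p f = field A p f - field B p f"
  using linear_frechet_derivative[OF orbit_differentiable[OF assms]]
  by (simp add: field_eq[OF assms] linear_diff)

lemma field_uminus:
  assumes "p \<in> topspace (mtop M)" "f \<in> smooth_funs M"
  shows "field (- A) p f = - field A p f"
  using linear_frechet_derivative[OF orbit_differentiable[OF assms]]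
  by (simp add: field_eq[OF assms] linear_neg)

text \<open>The formulas for fields hold at points of the manifold only, while HOL functions are
  total; chart expressions see no other points.\<close>

lemma smooth_funs_cong:
  assumes "f \<in> smooth_funs M" "\<And>q. q \<in> topspace (mtop M) \<Longrightarrow> f q = f' q"
  shows "f' \<in> smooth_funs M"
  unfolding smooth_funs_iff[OF charted_M]
proof clarify
  fix U \<phi> assume U: "(U, \<phi>) \<in> atlas M"
  have "smooth_on (\<phi> ` U) (f \<circ> inv_into U \<phi>)"
    using assms(1) U unfolding smooth_funs_iff[OF charted_M] by auto
  then show "smooth_on (\<phi> ` U) (f' \<circ> inv_into U \<phi>)"
    by (rule smooth_on_cong)
      (use assms(2) charted_subset_topspace[OF charted_M U] charted_inv_into[OF charted_M U] in auto)
qed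

lemma field_smooth:
  assumes "f \<in> smooth_funs M"
  shows "(\<lambda>p. field A p f) \<in> smooth_funs M"
proof -
  have "smooth_map (prod_mfd eucl_mfd M) eucl_mfd (\<lambda>z. f (case z of (g, p) \<Rightarrow> act g p))"
    using assms smooth_map_compose[OF charted_prod_mfd[OF charted_eucl_mfd charted_M] charted_M smooth_act]
    by (simp add: smooth_funs_def)
  then have "(\<lambda>z. f (case z of (g, p) \<Rightarrow> act g p)) \<in> smooth_funs (prod_mfd eucl_mfd M)"
    by (simp add: smooth_funs_def)
  from smooth_funs_partial_derivative[OF charted_M this]
  have "(\<lambda>p. frechet_derivative (\<lambda>g. f (act g p)) (at e) A) \<in> smooth_funs M" by simp
  then show ?thesis
    by (rule smooth_funs_cong) (simp add: field_eq assms)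
qed

lemma vector_field_field: "vector_field M (field A)"
  unfolding vector_field_def tangent_vector_def
proof (intro conjI ballI allI)
  fix p f g :: _ assume p: "p \<in> topspace (mtop M)" and f: "f \<in> smooth_funs M" and g: "g \<in> smooth_funs M"
  let ?c = "\<lambda>t. act (e + t *\<^sub>R A) p"
  \<comment> \<open>Linearity and the Leibniz rule are obtained by differentiating along the curve
    \<open>?c\<close>, from the derivatives of \<open>f\<close> and \<open>g\<close> along it. The
    curve starts at \<open>p\<close> because the unit acts trivially.\<close>
  note [derivative_intros] = field_has_real_derivative[OF p f, of A] field_has_real_derivative[OF p g, of A]
  show "field A p (\<lambda>q. a * f q + b * g q) = a * field A p f + b * field A p g" for a b
  proof -
    have "((\<lambda>t. a * f (?c t) + b * g (?c t)) has_real_derivative a * field A p f + b * field A p g) (at 0)"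
      by (auto intro!: derivative_eq_intros)
    then show ?thesis
      by (subst fundamental_field_def) (simp add: velocity_field_def DERIV_imp_deriv)
  qed
  have "((\<lambda>t. f (?c t) * g (?c t)) has_real_derivative f p * field A p g + g p * field A p f) (at 0)"
    by (auto intro!: derivative_eq_intros simp: act_unit[OF p])
  then show "field A p (\<lambda>q. f q * g q) = f p * field A p g + g p * field A p f"
    by (subst fundamental_field_def) (simp add: velocity_field_def DERIV_imp_deriv)
qed (rule field_smooth)

section \<open>Brackets of fundamental fields\<close>

lemma field_act:
  assumes "p \<in> topspace (mtop M)" "f \<in> smooth_funs M"
  shows "field A (act g p) f = frechet_derivative (\<lambda>h. f (act h p)) (at g) (mul A g)"
proof -
  let ?F = "\<lambda>h. f (act h p)"
  have "(?F has_derivative frechet_derivative ?F (at g)) (at (mul e g))"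
    using orbit_differentiable[OF assms] by (simp add: left_unit flip: frechet_derivative_works)
  \<comment> \<open>The orbit function of the point \<open>act g p\<close> is \<open>?F\<close>
    precomposed with right multiplication by \<open>g\<close>. This map is linear and sends
    \<open>e\<close> to \<open>g\<close>, so the chain rule turns the direction \<open>A\<close>
    into \<open>mul A g\<close>.\<close>
  then have "((\<lambda>h. ?F (mul h g)) has_derivative (\<lambda>v. frechet_derivative ?F (at g) (mul v g))) (at e)"
    by (rule has_derivative_compose[rotated])
      (rule bounded_linear_imp_has_derivative[OF mul.bounded_linear_left])
  then show ?thesis
    using assms by (simp add: field_eq act_in_topspace act_mul frechet_derivative_eqI)
qed

lemma field_field:
  assumes "p \<in> topspace (mtop M)" "f \<in> smooth_funs M"
  defines "F \<equiv> \<lambda>g. f (act g p)"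
  shows "field A p (\<lambda>q. field B q f) =
    frechet_derivative (\<lambda>g. frechet_derivative F (at g) B) (at e) A +
    frechet_derivative F (at e) (mul B A)"
proof -
  have "field A p (\<lambda>q. field B q f) = frechet_derivative (\<lambda>g. field B (act g p) f) (at e) A"
    using assms by (simp add: field_eq[OF assms(1)] field_smooth)
  \<comment> \<open>The inner field along the orbit is a derivative of \<open>F\<close> in a
    direction depending linearly on \<open>g\<close>, to which the two-term derivative formula
    applies.\<close>
  also have "(\<lambda>g. field B (act g p) f) = (\<lambda>g. frechet_derivative F (at g) (mul B g))"
    using assms by (simp add: field_act)
  also have "frechet_derivative \<dots> (at e) = (\<lambda>v. frechet_derivative (\<lambda>g. frechet_derivative F (at g) (mul B e)) (at e) v +
      frechet_derivative F (at e) (mul B v))"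
    unfolding F_def
    by (intro frechet_derivative_eqI has_derivative_directional_derivative
        smooth_orbit[OF assms(1,2)] mul.bounded_linear_right)
  finally show ?thesis by (simp add: right_unit)
qed

text \<open>The second-derivative terms cancel by symmetry. The reversed commutator reflects that
  fundamental fields of a left action form an anti-homomorphism.\<close>

lemma lie_bracket_field:
  assumes "p \<in> topspace (mtop M)" "f \<in> smooth_funs M"
  shows "lie_bracket (field A) (field B) p f = field (mul B A - mul A B) p f"
  using frechet_derivative_second_symmetric[OF smooth_orbit[OF assms], of A e B]
  by (simp add: lie_bracket_def field_field[OF assms] field_eq[OF assms]
      linear_diff[OF linear_frechet_derivative[OF orbit_differentiable[OF assms]]])

section \<open>Completeness, homogeneity structures and weights\<close>

lemma complete_field:
  assumes "mul A A = 0"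
  shows "complete_vector_field M (field A)"
  unfolding complete_vector_field_def
proof (intro conjI ballI vector_field_field)
  fix p assume p: "p \<in> topspace (mtop M)"
  let ?\<gamma> = "\<lambda>t. act (e + t *\<^sub>R A) p"
  have Ck: "Ck_on k UNIV (\<lambda>t. e + t *\<^sub>R A)" for k
    by (intro Ck_on_add Ck_on_const Ck_on_linear bounded_linear_scaleR_left open_UNIV)
  have "smooth_map (eucl_mfd :: (real, real) mfd) M ?\<gamma>"
    by (intro smooth_map_act charted_eucl_mfd smooth_map_const p)
      (simp add: smooth_map_eucl_iff smooth_on_UNIV_iff Ck)
  \<comment> \<open>The field at \<open>?\<gamma> t\<close> differentiates the orbit function in
    direction \<open>mul A (e + t *\<^sub>R A)\<close>. As the square of \<open>A\<close> vanishes,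
    this direction is \<open>A\<close>, the velocity of the line.\<close>
  moreover have "((\<lambda>s. f (?\<gamma> s)) has_real_derivative field A (?\<gamma> t) f) (at t)"
    if "f \<in> smooth_funs M" for f t
    using orbit_has_real_derivative[OF p that, of A t] assms
    by (simp add: field_act[OF p that] mul.add_right mul.scaleR_right right_unit)
  ultimately show "\<exists>\<gamma>. smooth_map (eucl_mfd :: (real, real) mfd) M \<gamma> \<and> \<gamma> 0 = p \<and>
      (\<forall>t. \<forall>f\<in>smooth_funs M. ((\<lambda>s. f (\<gamma> s)) has_real_derivative field A (\<gamma> t) f) (at t))"
    by (intro exI[of _ ?\<gamma>]) (auto simp: act_unit[OF p])
qed

lemma homogeneity_structure_idempotent:
  assumes "mul P P = P"
  shows "homogeneity_structure M (\<lambda>t. act (e + (t - 1) *\<^sub>R P))"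
  unfolding homogeneity_structure_def smooth_left_action_def
proof (intro conjI ballI allI)
  let ?A = "prod_mfd (eucl_mfd :: (real, real) mfd) M"
  have A: "charted ?A" by (intro charted_prod_mfd charted_eucl_mfd charted_M)
  have Ck: "Ck_on k UNIV (\<lambda>t. (e - P) + t *\<^sub>R P)" for k
    by (intro Ck_on_add Ck_on_const Ck_on_linear bounded_linear_scaleR_left open_UNIV)
  have "(\<lambda>t. e + (t - 1) *\<^sub>R P) = (\<lambda>t. (e - P) + t *\<^sub>R P)" by (simp add: algebra_simps)
  then have "smooth_map eucl_mfd eucl_mfd (\<lambda>t. e + (t - 1) *\<^sub>R P)"
    using Ck by (simp add: smooth_map_eucl_iff smooth_on_UNIV_iff)
  then have "smooth_map ?A eucl_mfd (\<lambda>z. e + (fst z - 1) *\<^sub>R P)"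
    by (rule smooth_map_compose[OF A charted_eucl_mfd, rotated])
      (intro smooth_map_fst smooth_manifold_eucl_mfd charted_M)
  then have "smooth_map ?A M (\<lambda>z. act (e + (fst z - 1) *\<^sub>R P) (snd z))"
    by (rule smooth_map_act[OF A]) (intro smooth_map_snd charted_eucl_mfd manifold)
  then show "smooth_map ?A M (\<lambda>(t, p). act (e + (t - 1) *\<^sub>R P) p)"
    by (simp add: case_prod_unfold)
next
  fix p s t assume p: "p \<in> topspace (mtop M)"
  show "act (e + (1 - 1) *\<^sub>R P) p = p" by (simp add: act_unit[OF p])
  \<comment> \<open>With \<open>e - P\<close> and \<open>P\<close> orthogonal idempotents, the
    factors are \<open>(e - P) + s *\<^sub>R P\<close> and \<open>(e - P) + t *\<^sub>R P\<close>,
    so only the coefficients of \<open>P\<close> multiply.\<close>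
  have "mul (e + (s - 1) *\<^sub>R P) (e + (t - 1) *\<^sub>R P) = e + (s * t - 1) *\<^sub>R P"
    using assms by (simp add: mul.add_left mul.add_right mul.diff_left mul.diff_right mul.scaleR_left mul.scaleR_right
        left_unit right_unit algebra_simps)
  then show "act (e + (s * t - 1) *\<^sub>R P) p = act (e + (s - 1) *\<^sub>R P) (act (e + (t - 1) *\<^sub>R P) p)"
    using act_mul[OF p] by metis
qed

text \<open>The mixed products of \<open>P\<close> and \<open>Q\<close> vanish, so both orders of
  multiplication give \<open>e + (t - 1) *\<^sub>R P + (s - 1) *\<^sub>R Q\<close>.\<close>

lemma double_graded_bundle_orthogonal_idempotents:
  assumes "mul P P = P" "mul Q Q = Q" "mul P Q = 0" "mul Q P = 0"
  shows "double_graded_bundle M (\<lambda>t. act (e + (t - 1) *\<^sub>R P)) (\<lambda>t. act (e + (t - 1) *\<^sub>R Q))"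
proof -
  have "act (e + (t - 1) *\<^sub>R P) (act (e + (s - 1) *\<^sub>R Q) p) =
      act (e + (s - 1) *\<^sub>R Q) (act (e + (t - 1) *\<^sub>R P) p)" if "p \<in> topspace (mtop M)" for s t p
    using assms by (simp add: mul.add_left mul.add_right mul.diff_left mul.diff_right mul.scaleR_left mul.scaleR_right
        left_unit right_unit algebra_simps flip: act_mul[OF that])
  then show ?thesis
    using assms by (simp add: double_graded_bundle_def manifold homogeneity_structure_idempotent)
qed

text \<open>The commutator hypotheses are written in the reversed order of the bracket formula: the
  bracket of the fields of \<open>P\<close> and \<open>A\<close> is the field of
  \<open>mul A P - mul P A\<close>, and so on. Stated for an abstract product, they serve left
  actions and, through the opposite product, right actions.\<close>

lemma double_graded_bundle_with_sl2_fields: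
  assumes "mul P P = P" "mul Q Q = Q" "mul P Q = 0" "mul Q P = 0"
    and "mul A A = 0" "mul B B = 0"
    and "mul A P - mul P A = A" "mul A Q - mul Q A = - A"
    and "mul B P - mul P B = - B" "mul B Q - mul Q B = B"
    and "mul B A - mul A B = P - Q"
  defines "h1 \<equiv> \<lambda>t. act (e + (t - 1) *\<^sub>R P)" and "h2 \<equiv> \<lambda>t. act (e + (t - 1) *\<^sub>R Q)"
  shows "double_graded_bundle M h1 h2 \<and>
    complete_vector_field M (field A) \<and> complete_vector_field M (field B) \<and>
    has_weight M h1 h2 (field A) 1 (-1) \<and> has_weight M h1 h2 (field B) (-1) 1 \<and>
    vf_eq M (lie_bracket (field A) (field B))
      (\<lambda>p f. weight_vector_field h1 p f - weight_vector_field h2 p f)"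
proof -
  have h: "weight_vector_field h1 = field P" "weight_vector_field h2 = field Q"
    unfolding h1_def h2_def by (rule weight_vector_field_affine)+
  have "double_graded_bundle M h1 h2"
    unfolding h1_def h2_def by (rule double_graded_bundle_orthogonal_idempotents) (fact assms)+
  then show ?thesis
    using assms(1-11)
    by (simp add: complete_field has_weight_def vf_eq_def h lie_bracket_field field_uminus field_diff[of _ _ P Q])
qed

end

section \<open>The monoid of two-by-two matrices\<close>

lemma mat2_times: "mat2 a b c d ** mat2 a' b' c' d' =
    mat2 (a * a' + b * c') (a * b' + b * d') (c * a' + d * c') (c * b' + d * d')"
  by (simp add: mat2_def vec_eq_iff forall_2 matrix_matrix_mult_def sum_2)

lemma mat2_diff: "mat2 a b c d - mat2 a' b' c' d' = mat2 (a - a') (b - b') (c - c') (d - d')"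
  by (simp add: mat2_def vec_eq_iff forall_2)

lemma mat2_uminus: "- mat2 a b c d = mat2 (- a) (- b) (- c) (- d)"
  by (simp add: mat2_def vec_eq_iff forall_2)

lemma mat2_zero: "mat2 0 0 0 0 = 0"
  by (simp add: mat2_def vec_eq_iff forall_2)

lemma mat2_one_plus: "mat 1 + t *\<^sub>R mat2 a b c d = mat2 (1 + t * a) (t * b) (t * c) (1 + t * d)"
  by (simp add: mat2_def vec_eq_iff forall_2 mat_def)

lemma bounded_bilinear_matrix_mult: "bounded_bilinear ((**) :: real^2^2 \<Rightarrow> _)"
  unfolding bilinear_conv_bounded_bilinear[symmetric] bilinear_def
  by (auto intro!: linearI simp: vec_eq_iff matrix_matrix_mult_def sum_2 algebra_simps)

lemma smooth_right_action_iff_opposite: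
  "smooth_right_action mul e M act \<longleftrightarrow> smooth_left_action (\<lambda>g h. mul h g) e M act"
  unfolding smooth_right_action_def smooth_left_action_def by blast

theorem lemma4p7:
  fixes M :: "('m, 'e::euclidean_space) mfd"
    and act :: "real^2^2 \<Rightarrow> 'm \<Rightarrow> 'm"
    and h1 h2 :: "real \<Rightarrow> 'm \<Rightarrow> 'm"
  assumes "smooth_manifold M"
    and "smooth_left_action (**) (mat 1) M act \<or> smooth_right_action (**) (mat 1) M act"
    and "h1 = (\<lambda>t. act (mat2 t 0 0 1))"
    and "h2 = (\<lambda>t. act (mat2 1 0 0 t))"
  shows "double_graded_bundle M h1 h2 \<and>
    (\<exists>X Y.
      (smooth_left_action (**) (mat 1) M act \<and> X = lower_field act \<and> Y = upper_field act \<or>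
       smooth_right_action (**) (mat 1) M act \<and> X = upper_field act \<and> Y = lower_field act) \<and>
      complete_vector_field M X \<and> complete_vector_field M Y \<and>
      has_weight M h1 h2 X 1 (-1) \<and> has_weight M h1 h2 Y (-1) 1 \<and>
      vf_eq M (lie_bracket X Y)
        (\<lambda>p f. weight_vector_field h1 p f - weight_vector_field h2 p f))"
proof -
  \<comment> \<open>These are the matrix units E11, E22, E12 and E21. The diagonal ones are
    orthogonal idempotents, the others square to zero.\<close>
  let ?P = "mat2 1 0 0 0" and ?Q = "mat2 0 0 0 1" and ?U = "mat2 0 1 0 0" and ?L = "mat2 0 0 1 0"
  have h1: "h1 = (\<lambda>t. act (mat 1 + (t - 1) *\<^sub>R ?P))" and h2: "h2 = (\<lambda>t. act (mat 1 + (t - 1) *\<^sub>R ?Q))"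
    using assms(3,4) by (simp_all add: mat2_one_plus)
  have upper: "upper_field act = fundamental_field (mat 1) act ?U"
    and lower: "lower_field act = fundamental_field (mat 1) act ?L"
    by (simp_all add: upper_field_def lower_field_def fundamental_field_def mat2_one_plus)
  note mat2 = mat2_times mat2_diff mat2_uminus mat2_zero
  from assms(2) show ?thesis
  proof
    assume left: "smooth_left_action (**) (mat 1) M act"
    then interpret smooth_monoid_action "(**)" "mat 1" M act
      by (intro smooth_monoid_action.intro bounded_bilinear_matrix_mult assms(1)) simp_all
    \<comment> \<open>For a left action the field of weight (1, -1) belongs to E21, since E21 E11 -
      E11 E21 = E21 and E21 E22 - E22 E21 = -E21. The bracket is the field of E12 E21 - E21 E12 =
      E11 - E22.\<close>
    have "double_graded_bundle M h1 h2 \<and>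
      complete_vector_field M (lower_field act) \<and> complete_vector_field M (upper_field act) \<and>
      has_weight M h1 h2 (lower_field act) 1 (-1) \<and> has_weight M h1 h2 (upper_field act) (-1) 1 \<and>
      vf_eq M (lie_bracket (lower_field act) (upper_field act))
        (\<lambda>p f. weight_vector_field h1 p f - weight_vector_field h2 p f)"
      unfolding h1 h2 upper lower
      by (rule double_graded_bundle_with_sl2_fields) (simp_all add: mat2)
    then show ?thesis
      by (intro conjI exI[of _ "lower_field act"] exI[of _ "upper_field act"] disjI1 left refl) simp_all
  next
    assume right: "smooth_right_action (**) (mat 1) M act"
    then interpret smooth_monoid_action "\<lambda>g h. h ** g" "mat 1" M act
      by (intro smooth_monoid_action.intro
          bounded_bilinear.flip[OF bounded_bilinear_matrix_mult] assms(1))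
        (simp_all add: smooth_right_action_iff_opposite)
    \<comment> \<open>Passing to the opposite product changes the sign of every commutator, so E12
      and E21 exchange their roles.\<close>
    have "double_graded_bundle M h1 h2 \<and>
      complete_vector_field M (upper_field act) \<and> complete_vector_field M (lower_field act) \<and>
      has_weight M h1 h2 (upper_field act) 1 (-1) \<and> has_weight M h1 h2 (lower_field act) (-1) 1 \<and>
      vf_eq M (lie_bracket (upper_field act) (lower_field act))
        (\<lambda>p f. weight_vector_field h1 p f - weight_vector_field h2 p f)"
      unfolding h1 h2 upper lower
      by (rule double_graded_bundle_with_sl2_fields) (simp_all add: mat2)
    then show ?thesis
      by (intro conjI exI[of _ "upper_field act"] exI[of _ "lower_field act"] disjI2 right refl) simp_all
  qed
qed

end
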